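(* Let $n\ge1$, let $U\subset\mathbb{R}^{2n}$ be an open, bounded, connected set with Lipschitz boundary, let $s:U\to\mathbb{R}^{2n}$ be measure preserving, and let $1\le p<\infty$. For any $\epsilon>0$ there exists a $C^\infty$ diffeomorphism $S:\mathbb{R}^{2n}\to\mathbb{R}^{2n}$ which is symplectic and generated by a Hamiltonian vector field, such that $$\int_U|s-S|^p\,dx\le\epsilon.$$
   Context: For $A\subset\mathbb{R}^{2n}$ measurable, a map $s\in L^\infty(A,\mathbb{R}^{2n})$ is measure preserving if there exists a measurable set $B\subset\mathbb{R}^{2n}$ with $s_\#(\mathcal{H}^{2n}\llcorner A)=\mathcal{H}^{2n}\llcorner B$ (push-forward of Lebesgue measure restricted to $A$). Let $J=\begin{bmatrix}0_{n\times n}&-1_{n\times n}\\1_{n\times n}&0_{n\times n}\end{bmatrix}$, where $1_{n\times n}$ is the identity matrix. A map $S$ is symplectic if it is differentiable a.e. with $DS(x)^TJ\,DS(x)=J$ for a.e. $x$ in its domain. The symplectic map generated by the (flow of the) Hamiltonian vector field $D\gamma\cdot J$, where $\gamma\in C^1(\mathbb{R}^{2n},\mathbb{R})$, is $x\mapsto\phi(x,1)$, where $\frac{d}{dt}\phi(x,t)=D\gamma(\phi(x,t))\cdot J$ and $\phi(x,0)=x$. *)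

theory Defs
  imports "HOL-Analysis.Analysis"
begin

text \<open>
  The space \<open>\<real>\<^sup>2\<^sup>n\<close> is \<open>real^('n + 'n)\<close>, where \<open>n = CARD('n)\<close>, which is at least 1: the indices
  \<open>Inl i\<close> are the first \<open>n\<close> coordinates and the indices \<open>Inr i\<close> the last \<open>n\<close>.
\<close>

definition J_mat :: "real^('n::finite + 'n)^('n + 'n)" where
  "J_mat = (\<chi> a b. case a of
       Inl i \<Rightarrow> (case b of Inl j \<Rightarrow> 0 | Inr j \<Rightarrow> - (mat 1 :: real^'n^'n) $ i $ j)
     | Inr i \<Rightarrow> (case b of Inl j \<Rightarrow> (mat 1 :: real^'n^'n) $ i $ j | Inr j \<Rightarrow> 0))"

text \<open>
  The first two conjuncts say that \<open>s\<close> is essentially bounded on \<open>A\<close>. In the last one both sides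
  are Borel measures on the whole space; the right-hand side is \<open>E \<mapsto> |E \<inter> B|\<close>.
\<close>

definition measure_preserving_on ::
  "'a::euclidean_space set \<Rightarrow> ('a \<Rightarrow> 'a) \<Rightarrow> bool" where
  "measure_preserving_on A s \<longleftrightarrow>
     s \<in> borel_measurable (lebesgue_on A) \<and>
     (\<exists>C. AE x in lebesgue_on A. norm (s x) \<le> C) \<and>
     (\<exists>B \<in> sets lebesgue. distr (lebesgue_on A) borel s = distr (lebesgue_on B) borel (\<lambda>x. x))"

text \<open>
  Near each boundary point, \<open>U\<close> is the strict epigraph, in some direction \<open>e\<close>, of a Lipschitz
  function on the hyperplane orthogonal to \<open>e\<close>; \<open>y - (y \<bullet> e) *\<^sub>R e\<close> is the orthogonal projection
  of \<open>y\<close> onto that hyperplane.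
\<close>

definition lipschitz_boundary :: "'a::euclidean_space set \<Rightarrow> bool" where
  "lipschitz_boundary U \<longleftrightarrow>
     (\<forall>x \<in> frontier U. \<exists>r > 0. \<exists>e g L. norm e = 1 \<and> L-lipschitz_on {z. z \<bullet> e = 0} g \<and>
        U \<inter> ball x r = {y \<in> ball x r. g (y - (y \<bullet> e) *\<^sub>R e) < y \<bullet> e})"

text \<open>\<open>C^k\<close> regularity on the whole space, through iterated directional derivatives.\<close>

primrec Ck_map :: "nat \<Rightarrow> ('a::euclidean_space \<Rightarrow> 'b::euclidean_space) \<Rightarrow> bool" where
  "Ck_map 0 f \<longleftrightarrow> continuous_on UNIV f"
| "Ck_map (Suc k) f \<longleftrightarrow>
     (\<forall>x. f differentiable (at x)) \<and> (\<forall>v. Ck_map k (\<lambda>x. frechet_derivative f (at x) v))"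

definition smooth_diffeomorphism :: "('a::euclidean_space \<Rightarrow> 'a) \<Rightarrow> bool" where
  "smooth_diffeomorphism S \<longleftrightarrow> bij S \<and> (\<forall>k. Ck_map k S) \<and> (\<forall>k. Ck_map k (inv S))"

definition symplectic_on ::
  "(real^('n::finite + 'n)) set \<Rightarrow> (real^('n + 'n) \<Rightarrow> real^('n + 'n)) \<Rightarrow> bool" where
  "symplectic_on D S \<longleftrightarrow>
     (AE x in lebesgue_on D. S differentiable (at x within D) \<and>
        transpose (jacobian S (at x within D)) ** J_mat ** jacobian S (at x within D) = J_mat)"

text \<open>The derivative \<open>D\<gamma>(x)\<close> is the row vector of partial derivatives, hence \<open>v*\<close>.\<close>

definition hamiltonian_vector_field ::
  "(real^('n::finite + 'n) \<Rightarrow> real) \<Rightarrow> real^('n + 'n) \<Rightarrow> real^('n + 'n)" where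
  "hamiltonian_vector_field \<gamma> x = (\<chi> i. frechet_derivative \<gamma> (at x) (axis i 1)) v* J_mat"

definition generated_by_hamiltonian ::
  "(real^('n::finite + 'n) \<Rightarrow> real^('n + 'n)) \<Rightarrow> bool" where
  "generated_by_hamiltonian S \<longleftrightarrow>
     (\<exists>\<gamma> \<phi>. Ck_map 1 \<gamma> \<and>
        (\<forall>x. \<phi> x 0 = x) \<and>
        (\<forall>x t. (\<phi> x has_vector_derivative hamiltonian_vector_field \<gamma> (\<phi> x t)) (at t)) \<and>
        (\<forall>x. S x = \<phi> x 1))"

end

theory Submission
  imports Defs
begin

text \<open>
  For a smooth bounded \<open>g\<close> and a vector \<open>w\<close> the map \<open>x \<mapsto> x + g (\<omega>(x, w)) w\<close> is a symplectic
  diffeomorphism. If \<open>g\<close> is locally constant, it translates each of finitely many slabs by its own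
  multiple of \<open>w\<close>, with a displacement bound independent of how thin the transition zones between
  the slabs are. Finitely many such maps first pull the cubes of a grid far apart and then line them
  up in any prescribed order, cube number \<open>i\<close> being centered at \<open>i v\<close>. With \<open>h\<close> their composition,
  \<open>S x = h\<inverse> (h x + v)\<close> translates each cube onto the next one, and it is the time-one map of the flow
  \<open>h\<inverse> (h x + t v)\<close> of the autonomous Hamiltonian \<open>\<omega>(h x, v)\<close>.

  It remains to order the cubes of a fine grid so that \<open>s\<close> maps most of each cube close to the next
  one. Since the preimage of a coarse cube is no larger than the cube, \<open>s\<close> is approximated by a
  permutation \<open>f\<close> of fine cubes. Cutting each cube into \<open>M\<close> pieces and sending piece \<open>j\<close> of \<open>t\<close> to
  piece \<open>j + 1\<close> of \<open>f t\<close> breaks up all cycles of \<open>f\<close> and loses only the fraction \<open>1 / M\<close>.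
\<close>

section \<open>Iterated differentiability\<close>

lemma Ck_map_cong_ext:
  assumes "Ck_map k f" "\<And>x. f x = g x" shows "Ck_map k g"
proof -
  have "f = g" using assms(2) by auto
  with assms(1) show ?thesis by simp
qed

text \<open>\<open>Ck_map\<close> speaks of the chosen \<open>frechet_derivative\<close>. By
  uniqueness of the derivative any explicit formula for it may be used instead.\<close>

lemma Ck_map_SucI:
  assumes "\<And>x. (f has_derivative f' x) (at x)" "\<And>v. Ck_map k (\<lambda>x. f' x v)"
  shows "Ck_map (Suc k) f"
proof -
  have "frechet_derivative f (at x) = f' x" for x
    using frechet_derivative_at[OF assms(1)] by simp
  then show ?thesis using assms by (auto simp: differentiable_def)
qed

lemma Ck_map_SucD:
  assumes "Ck_map (Suc k) f"
  shows "(f has_derivative frechet_derivative f (at x)) (at x)"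
    "Ck_map k (\<lambda>x. frechet_derivative f (at x) v)"
  using assms by (auto simp: frechet_derivative_works[symmetric])

lemma Ck_map_lower: "Ck_map (Suc k) f \<Longrightarrow> Ck_map k f"
proof (induction k arbitrary: f)
  case 0
  then have "\<And>x. f differentiable (at x)" by simp
  then have "f differentiable_on UNIV"
    by (simp add: differentiable_on_def)
  then show ?case by (simp add: differentiable_imp_continuous_on)
next
  case (Suc k)
  then show ?case by (metis Ck_map.simps(2))
qed

lemma Ck_map_const: "Ck_map k (\<lambda>x. c)"
proof (induction k arbitrary: c)
  case (Suc k)
  show ?case by (rule Ck_map_SucI[where f' = "\<lambda>x v. 0"]) (auto intro: Suc)
qed simp

lemma Ck_map_linear:
  assumes "bounded_linear L" shows "Ck_map k L"
proof (cases k)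
  case 0
  then show ?thesis using linear_continuous_on[OF assms] by simp
next
  case (Suc j)
  show ?thesis unfolding Suc
    by (rule Ck_map_SucI[where f' = "\<lambda>x. L"])
       (auto intro: Ck_map_const bounded_linear.has_derivative[OF assms] bounded_linear_imp_has_derivative[OF assms])
qed

lemma Ck_map_id: "Ck_map k (\<lambda>x. x)"
  by (rule Ck_map_linear) (rule bounded_linear_ident)

lemma Ck_map_linear_comp:
  assumes "bounded_linear L" "Ck_map k f" shows "Ck_map k (\<lambda>x. L (f x))"
  using assms(2)
proof (induction k arbitrary: f)
  case 0
  then show ?case using bounded_linear.continuous_on[OF assms(1)] by simp
next
  case (Suc k)
  show ?case
    by (rule Ck_map_SucI[where f' = "\<lambda>x v. L (frechet_derivative f (at x) v)"])
       (auto intro!: Suc.IH bounded_linear.has_derivative[OF assms(1)] Ck_map_SucD[OF Suc.prems])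
qed

lemma Ck_map_add:
  assumes "Ck_map k f" "Ck_map k g" shows "Ck_map k (\<lambda>x. f x + g x)"
  using assms
proof (induction k arbitrary: f g)
  case (Suc k)
  show ?case
    by (rule Ck_map_SucI[where f' = "\<lambda>x v. frechet_derivative f (at x) v + frechet_derivative g (at x) v"])
       (auto intro!: Suc.IH has_derivative_add Ck_map_SucD[OF Suc.prems(1)] Ck_map_SucD[OF Suc.prems(2)])
qed (auto intro: continuous_intros)

lemma Ck_map_scaleR:
  fixes f :: "'a::euclidean_space \<Rightarrow> real"
  assumes "Ck_map k f" "Ck_map k g" shows "Ck_map k (\<lambda>x. f x *\<^sub>R g x)"
  using assms
proof (induction k arbitrary: f g)
  case (Suc k)
  show ?case
    by (rule Ck_map_SucI[where f' = "\<lambda>x v. f x *\<^sub>R frechet_derivative g (at x) v + frechet_derivative f (at x) v *\<^sub>R g x"])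
       (auto intro!: Suc.IH Ck_map_add has_derivative_scaleR Ck_map_SucD[OF Suc.prems(1)] Ck_map_SucD[OF Suc.prems(2)]
         Ck_map_lower[OF Suc.prems(1)] Ck_map_lower[OF Suc.prems(2)])
qed (auto intro: continuous_intros)

lemma Ck_map_sum:
  assumes "\<And>i. i \<in> I \<Longrightarrow> Ck_map k (f i)" shows "Ck_map k (\<lambda>x. \<Sum>i\<in>I. f i x)"
  using assms by (induction I rule: infinite_finite_induct) (auto intro: Ck_map_const Ck_map_add)

text \<open>The chain rule applies the derivative of \<open>f\<close> to a direction that varies
  with \<open>x\<close>, while the induction hypothesis covers fixed directions only. Expanding the
  direction in \<open>Basis\<close> leaves scalar coefficients times derivatives in fixed
  directions.\<close>

lemma Ck_map_compose:
  assumes "Ck_map k f" "Ck_map k g" shows "Ck_map k (\<lambda>x. f (g x))"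
  using assms
proof (induction k arbitrary: f g)
  case 0
  then show ?case by (auto intro: continuous_on_compose2)
next
  case (Suc k)
  note f = Ck_map_SucD[OF Suc.prems(1)] and g = Ck_map_SucD[OF Suc.prems(2)]
  show ?case
  proof (rule Ck_map_SucI)
    fix x
    show "((\<lambda>x. f (g x)) has_derivative
      (\<lambda>v. frechet_derivative f (at (g x)) (frechet_derivative g (at x) v))) (at x)"
      using has_derivative_compose[OF g(1) f(1)] by simp
  next
    fix v
    have lin: "linear (frechet_derivative f (at (g x)))" for x
      using f(1) has_derivative_linear by blast
    have "(\<Sum>b\<in>Basis. (frechet_derivative g (at x) v \<bullet> b) *\<^sub>R frechet_derivative f (at (g x)) b)
        = frechet_derivative f (at (g x)) (\<Sum>b\<in>Basis. (frechet_derivative g (at x) v \<bullet> b) *\<^sub>R b)" for x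
      by (simp add: linear_sum[OF lin] linear_scale[OF lin])
    then have "(\<Sum>b\<in>Basis. (frechet_derivative g (at x) v \<bullet> b) *\<^sub>R frechet_derivative f (at (g x)) b)
        = frechet_derivative f (at (g x)) (frechet_derivative g (at x) v)" for x
      by (simp add: euclidean_representation)
    moreover have "Ck_map k (\<lambda>x. \<Sum>b\<in>Basis. (frechet_derivative g (at x) v \<bullet> b) *\<^sub>R frechet_derivative f (at (g x)) b)"
      by (intro Ck_map_sum Ck_map_scaleR Ck_map_linear_comp[OF bounded_linear_inner_left] g
           Suc.IH[where g = g] Ck_map_lower[OF Suc.prems(2)] f)
    ultimately show "Ck_map k (\<lambda>x. frechet_derivative f (at (g x)) (frechet_derivative g (at x) v))"
      by (rule Ck_map_cong_ext[rotated])
  qed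
qed

lemma Ck_map_diff:
  "Ck_map k f \<Longrightarrow> Ck_map k g \<Longrightarrow> Ck_map k (\<lambda>x. f x - g x)"
  using Ck_map_add[of k f "\<lambda>x. - g x"] Ck_map_linear_comp[OF bounded_linear_minus[OF bounded_linear_ident], of k g]
  by simp

lemma Ck_map_mult:
  fixes f g :: "'a::euclidean_space \<Rightarrow> real"
  assumes "Ck_map k f" "Ck_map k g" shows "Ck_map k (\<lambda>x. f x * g x)"
  using Ck_map_scaleR[OF assms] by simp

section \<open>Smooth functions on the line\<close>

text \<open>The powers of \<open>inverse x\<close> make the family closed under differentiation:
  each derivative is a linear combination of two members. One induction over the order, for all
  \<open>m\<close> at once, then gives smoothness.\<close>

definition flat_exp :: "nat \<Rightarrow> real \<Rightarrow> real" where
  "flat_exp m x = (if x > 0 then inverse x ^ m * exp (- inverse x) else 0)"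

lemma flat_exp_right_limit: "(flat_exp m \<longlongrightarrow> 0) (at_right 0)"
proof -
  have "((\<lambda>x. x ^ m / exp x) \<longlongrightarrow> (0::real)) at_top" by (rule tendsto_power_div_exp_0)
  then have "((\<lambda>x. inverse x ^ m / exp (inverse x)) \<longlongrightarrow> (0::real)) (at_right 0)"
    by (rule filterlim_compose) (rule filterlim_inverse_at_top_right)
  moreover have "\<forall>\<^sub>F x in at_right 0. inverse x ^ m / exp (inverse x) = flat_exp m x"
    by (auto simp: flat_exp_def eventually_at_filter exp_minus divide_inverse)
  ultimately show ?thesis by (rule Lim_transform_eventually)
qed

lemma flat_exp_deriv:
  "(flat_exp m has_real_derivative (flat_exp (m+2) x - m * flat_exp (m+1) x)) (at x)"
proof -
  consider "x > 0" | "x < 0" | "x = 0" by linarith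
  then show ?thesis
  proof cases
    case 1
    have inv: "(inverse has_real_derivative - (inverse x)\<^sup>2) (at x)"
      using 1 DERIV_inverse[of x] by (simp add: numeral_2_eq_2)
    have pow: "((\<lambda>x. inverse x ^ m) has_real_derivative - (m * inverse x ^ (m + 1))) (at x)"
      using DERIV_power[OF inv, of m] by (cases m) (simp_all add: power2_eq_square mult_ac)
    have ex: "((\<lambda>x. exp (- inverse x)) has_real_derivative exp (- inverse x) * (inverse x)\<^sup>2) (at x)"
      using DERIV_chain2[OF DERIV_exp DERIV_minus[OF inv]] by simp
    have "((\<lambda>x. inverse x ^ m * exp (- inverse x)) has_real_derivative
      (flat_exp (m+2) x - m * flat_exp (m+1) x)) (at x)"
      using DERIV_mult[OF pow ex] 1 by (simp add: flat_exp_def power2_eq_square algebra_simps)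
    then show ?thesis
      by (rule has_field_derivative_transform_within_open[of _ _ _ "{0<..}"])
         (use 1 in \<open>auto simp: flat_exp_def\<close>)
  next
    case 2
    have "((\<lambda>x. 0) has_real_derivative (flat_exp (m+2) x - m * flat_exp (m+1) x)) (at x)"
      using 2 by (simp add: flat_exp_def)
    then show ?thesis
      by (rule has_field_derivative_transform_within_open[of _ _ _ "{..<0}"])
         (use 2 in \<open>auto simp: flat_exp_def\<close>)
  next
    case 3
    \<comment> \<open>At 0 the difference quotient is \<open>flat_exp (Suc m)\<close> on the right
      and 0 on the left.\<close>
    have "((\<lambda>h. flat_exp m h / h) \<longlongrightarrow> 0) (at_right 0)"
      by (rule Lim_transform_eventually[OF flat_exp_right_limit[of "Suc m"]])
         (auto simp: eventually_at_filter flat_exp_def divide_inverse)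
    moreover have "((\<lambda>h. flat_exp m h / h) \<longlongrightarrow> 0) (at_left 0)"
      by (rule Lim_transform_eventually[OF tendsto_const[of 0]])
         (auto simp: eventually_at_filter flat_exp_def)
    ultimately have "((\<lambda>h. flat_exp m h / h) \<longlongrightarrow> 0) (at 0)"
      by (simp add: filterlim_split_at)
    then show ?thesis using 3 by (simp add: DERIV_def flat_exp_def)
  qed
qed

lemma Ck_map_flat_exp: "Ck_map k (flat_exp m)"
proof (induction k arbitrary: m)
  case 0
  have "isCont (flat_exp m) x" for x using flat_exp_deriv DERIV_isCont by blast
  then show ?case by (simp add: continuous_at_imp_continuous_on)
next
  case (Suc k)
  show ?case
  proof (rule Ck_map_SucI)
    show "(flat_exp m has_derivative (*) (flat_exp (m+2) x - m * flat_exp (m+1) x)) (at x)" for x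
      using flat_exp_deriv by (simp add: has_field_derivative_def)
  qed (intro Ck_map_mult Ck_map_diff Ck_map_const Suc)
qed

text \<open>Nesting \<open>exp (- 1 / x)\<close> in itself gives a plateau function without any division.\<close>

lemma smooth_step_exists:
  fixes a b :: real
  assumes "a < b"
  shows "\<exists>f::real \<Rightarrow> real. (\<forall>k. Ck_map k f) \<and> (\<forall>x. 0 \<le> f x \<and> f x \<le> 1) \<and>
    (\<forall>x\<le>a. f x = 1) \<and> (\<forall>x\<ge>b. f x = 0)"
proof -
  let ?e = "flat_exp 0"
  \<comment> \<open>The argument of the outer function is 1 up to \<open>a\<close> and at most 0
    from \<open>b\<close> on; \<open>exp 1\<close> is the reciprocal of the outer function's value
    at 1.\<close>
  define f where "f = (\<lambda>x. exp 1 * ?e (1 - ?e (x - a) * inverse (?e (b - a))))"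
  have pos: "?e (b - a) > 0" using assms by (simp add: flat_exp_def)
  have mono: "?e x \<le> ?e y" if "x \<le> y" for x y
    using that by (auto simp: flat_exp_def)
  have "Ck_map k f" for k unfolding f_def
    by (intro Ck_map_mult Ck_map_const Ck_map_compose[OF Ck_map_flat_exp] Ck_map_diff Ck_map_id)
  moreover have "0 \<le> f x \<and> f x \<le> 1" for x
  proof -
    have "0 \<le> ?e (x - a) * inverse (?e (b - a))"
      using pos by (simp add: flat_exp_def)
    then have "?e (1 - ?e (x - a) * inverse (?e (b - a))) \<le> ?e 1" by (intro mono) simp
    moreover have "?e 1 = inverse (exp 1)" by (simp add: flat_exp_def exp_minus)
    ultimately have "f x \<le> exp 1 * inverse (exp 1)"
      unfolding f_def by (intro mult_left_mono) auto
    then have "f x \<le> 1" by simp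
    moreover have "0 \<le> f x" by (simp add: f_def flat_exp_def)
    ultimately show ?thesis by simp
  qed
  moreover have "f x = 1" if "x \<le> a" for x
    using that by (simp add: f_def flat_exp_def exp_minus)
  moreover have "f x = 0" if "x \<ge> b" for x
  proof -
    have "?e (b - a) \<le> ?e (x - a)" using that by (intro mono) simp
    then have "1 - ?e (x - a) * inverse (?e (b - a)) \<le> 0" using pos by (simp add: field_simps)
    then show ?thesis by (simp add: f_def flat_exp_def)
  qed
  ultimately show ?thesis by blast
qed

lemma smooth_bump_exists:
  fixes t :: real
  assumes "a < b"
  shows "\<exists>f::real \<Rightarrow> real. (\<forall>k. Ck_map k f) \<and> (\<forall>x. 0 \<le> f x \<and> f x \<le> 1) \<and>
    (\<forall>x. \<bar>x - t\<bar> \<le> a \<longrightarrow> f x = 1) \<and> (\<forall>x. \<bar>x - t\<bar> \<ge> b \<longrightarrow> f x = 0)"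
proof -
  obtain f :: "real \<Rightarrow> real" where f: "\<And>k. Ck_map k f" "\<And>x. 0 \<le> f x \<and> f x \<le> 1"
    "\<And>x. x \<le> a \<Longrightarrow> f x = 1" "\<And>x. x \<ge> b \<Longrightarrow> f x = 0"
    using smooth_step_exists[OF assms] by blast
  have "Ck_map k (\<lambda>x. f (x - t) * f (t - x))" for k
    by (intro Ck_map_mult Ck_map_compose[OF f(1)] Ck_map_diff Ck_map_id Ck_map_const)
  moreover have "0 \<le> f (x - t) * f (t - x) \<and> f (x - t) * f (t - x) \<le> 1" for x
    using f(2) by (simp add: mult_le_one)
  moreover have "f (x - t) * f (t - x) = 1" if "\<bar>x - t\<bar> \<le> a" for x
    using that f(3)[of "x - t"] f(3)[of "t - x"] by simp
  moreover have "f (x - t) * f (t - x) = 0" if "\<bar>x - t\<bar> \<ge> b" for x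
  proof (cases "x \<ge> t")
    case True
    then show ?thesis using that f(4)[of "x - t"] by simp
  next
    case False
    then show ?thesis using that f(4)[of "t - x"] by simp
  qed
  ultimately show ?thesis
    by (intro exI[of _ "\<lambda>x. f (x - t) * f (t - x)"]) simp
qed

lemma smooth_interpolation:
  fixes t \<alpha> :: "'i \<Rightarrow> real"
  assumes "finite I" "\<rho> < r" "0 \<le> A" "\<And>i. i \<in> I \<Longrightarrow> \<bar>\<alpha> i\<bar> \<le> A"
    and "\<And>i j. i \<in> I \<Longrightarrow> j \<in> I \<Longrightarrow> \<alpha> i \<noteq> \<alpha> j \<Longrightarrow> 2 * r \<le> \<bar>t i - t j\<bar>"
  shows "\<exists>g::real \<Rightarrow> real. (\<forall>k. Ck_map k g) \<and> (\<forall>x. \<bar>g x\<bar> \<le> A) \<and>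
    (\<forall>i\<in>I. \<forall>x. \<bar>x - t i\<bar> \<le> \<rho> \<longrightarrow> g x = \<alpha> i)"
  using assms
proof (induction I rule: finite_induct)
  case empty
  then show ?case by (intro exI[of _ "\<lambda>_. 0"]) (auto intro: Ck_map_const)
next
  case (insert i I)
  obtain g :: "real \<Rightarrow> real" where g: "\<And>k. Ck_map k g" "\<And>x. \<bar>g x\<bar> \<le> A"
    "\<And>j x. j \<in> I \<Longrightarrow> \<bar>x - t j\<bar> \<le> \<rho> \<Longrightarrow> g x = \<alpha> j"
    using insert.IH insert.prems by (metis (no_types, lifting) insertCI)
  \<comment> \<open>The intervals of radius \<open>\<rho>\<close> about points \<open>t j\<close>
    with another value have distance at least \<open>2 * r - \<rho>\<close> from \<open>t i\<close>,
    so \<open>f\<close> vanishes on them.\<close>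
  obtain f :: "real \<Rightarrow> real" where f: "\<And>k. Ck_map k f" "\<And>x. 0 \<le> f x \<and> f x \<le> 1"
    "\<And>x. \<bar>x - t i\<bar> \<le> \<rho> \<Longrightarrow> f x = 1" "\<And>x. \<bar>x - t i\<bar> \<ge> 2 * r - \<rho> \<Longrightarrow> f x = 0"
    using smooth_bump_exists[of \<rho> "2 * r - \<rho>" "t i"] insert.prems(1) by auto
  define G where "G = (\<lambda>x. (1 - f x) * g x + f x * \<alpha> i)"
  have "Ck_map k G" for k unfolding G_def
    by (intro Ck_map_add Ck_map_mult Ck_map_diff Ck_map_const f g)
  moreover have "\<bar>G x\<bar> \<le> A" for x
  proof -
    have "\<bar>(1 - f x) * g x + f x * \<alpha> i\<bar> \<le> (1 - f x) * A + f x * A"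
      using f(2)[of x] g(2)[of x] insert.prems(3)[of i]
      by (intro order.trans[OF abs_triangle_ineq] add_mono) (auto simp: abs_mult mult_left_mono)
    then show ?thesis by (simp add: G_def algebra_simps)
  qed
  moreover have "G x = \<alpha> j" if "j \<in> insert i I" "\<bar>x - t j\<bar> \<le> \<rho>" for j x
  proof (cases "j \<in> I")
    case False
    with that f(3) show ?thesis by (simp add: G_def)
  next
    case True
    show ?thesis
    proof (cases "\<alpha> i = \<alpha> j")
      case True
      then show ?thesis using g(3)[OF \<open>j \<in> I\<close> that(2)] by (simp add: G_def algebra_simps)
    next
      case False
      then have "2 * r \<le> \<bar>t i - t j\<bar>" using insert.prems(4) True by auto
      then have "f x = 0" using that(2) by (intro f(4)) linarith
      then show ?thesis using g(3)[OF \<open>j \<in> I\<close> that(2)] by (simp add: G_def)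
    qed
  qed
  ultimately show ?case by blast
qed

section \<open>Symplectic transvections\<close>

text \<open>This is the symplectic form belonging to \<open>J_mat\<close>: the matrix identity in
  \<open>symplectic_on\<close> says that the derivative preserves it.\<close>

definition omega :: "real^('n::finite + 'n) \<Rightarrow> real^('n + 'n) \<Rightarrow> real" where
  "omega x y = x \<bullet> (J_mat *v y)"

lemma sum_UNIV_sum_type:
  "(\<Sum>k\<in>UNIV. f k) = (\<Sum>i\<in>UNIV. f (Inl i)) + (\<Sum>i\<in>UNIV. f (Inr i))"
  for f :: "'n::finite + 'n \<Rightarrow> real"
  using sum.Plus[of UNIV UNIV f] by (simp add: UNIV_Plus_UNIV)

lemma J_mult_nth:
  "(J_mat *v y) $ Inl i = - y $ Inr i" "(J_mat *v y) $ Inr i = y $ Inl i"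
  by (simp_all add: J_mat_def matrix_vector_mult_def sum_UNIV_sum_type mat_def if_distrib[of "\<lambda>x. x * _"] sum_negf
      cong: if_cong)

lemma J_J: "J_mat *v (J_mat *v y) = - y"
proof -
  have "(J_mat *v (J_mat *v y)) $ k = (- y) $ k" for k by (cases k) (simp_all add: J_mult_nth)
  then show ?thesis by (simp add: vec_eq_iff)
qed

lemma omega_coords: "omega x y = (\<Sum>i\<in>UNIV. x $ Inr i * y $ Inl i - x $ Inl i * y $ Inr i)"
  by (simp add: omega_def inner_vec_def sum_UNIV_sum_type J_mult_nth sum_subtractf sum_negf)

lemma omega_antisym: "omega x y = - omega y x"
  by (simp add: omega_coords sum_negf[symmetric] algebra_simps)

lemma omega_self: "omega w w = 0"
  using omega_antisym[of w w] by simp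

lemma omega_add_left: "omega (x + y) w = omega x w + omega y w"
  by (simp add: omega_def inner_add_left)

lemma omega_diff_left: "omega (x - y) w = omega x w - omega y w"
  by (simp add: omega_def inner_diff_left)

lemma omega_scale_left: "omega (a *\<^sub>R x) w = a * omega x w"
  by (simp add: omega_def)

lemma omega_add_right: "omega w (x + y) = omega w x + omega w y"
  by (simp add: omega_def matrix_vector_right_distrib inner_add_right)

lemma omega_scale_right: "omega w (a *\<^sub>R x) = a * omega w x"
  by (simp add: omega_def matrix_vector_mult_scaleR)

lemma bounded_linear_omega: "bounded_linear (\<lambda>x. omega x w)"
  by (simp add: omega_def bounded_linear_inner_left)

text \<open>Canonically conjugate coordinates: a shear along an axis is governed by the coordinate
  conjugate to it.\<close>

definition conj_index :: "'n + 'n \<Rightarrow> 'n + 'n" where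
  "conj_index k = (case k of Inl i \<Rightarrow> Inr i | Inr i \<Rightarrow> Inl i)"

lemma conj_index_conj [simp]: "conj_index (conj_index k) = k"
  by (cases k) (simp_all add: conj_index_def)

lemma omega_axis:
  "omega x (axis k 1) = (case k of Inl i \<Rightarrow> x $ Inr i | Inr i \<Rightarrow> - x $ Inl i)"
  by (cases k) (simp_all add: omega_coords axis_def if_distrib[of "\<lambda>x. _ * x"] sum_negf cong: if_cong)

lemma abs_omega_axis: "\<bar>omega x (axis k 1)\<bar> = \<bar>x $ conj_index k\<bar>"
  by (cases k) (simp_all add: omega_axis conj_index_def)

text \<open>\<open>J_mat\<close> permutes coordinates up to sign, so this is the duality of the sup
  norm and the sum norm. A cube of half-side \<open>\<rho>\<close> thus lies in a slab of known
  half-width between level sets of \<open>omega _ w\<close>.\<close>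

lemma omega_box:
  assumes "\<And>k. \<bar>x $ k\<bar> \<le> \<rho>"
  shows "\<bar>omega x w\<bar> \<le> \<rho> * (\<Sum>k\<in>UNIV. \<bar>w $ k\<bar>)"
proof -
  have "\<bar>omega x w\<bar> \<le> (\<Sum>i\<in>UNIV. \<bar>x $ Inr i * w $ Inl i - x $ Inl i * w $ Inr i\<bar>)"
    unfolding omega_coords by (rule sum_abs)
  also have "\<dots> \<le> (\<Sum>i\<in>UNIV. \<rho> * \<bar>w $ Inl i\<bar> + \<rho> * \<bar>w $ Inr i\<bar>)"
    by (intro sum_mono order.trans[OF abs_triangle_ineq4] add_mono)
       (simp_all add: abs_mult mult_right_mono assms)
  also have "\<dots> = \<rho> * (\<Sum>k\<in>UNIV. \<bar>w $ k\<bar>)"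
    by (simp add: sum_UNIV_sum_type sum.distrib sum_distrib_left distrib_left)
  finally show ?thesis .
qed

text \<open>The inverse is carried along as a second map: its smoothness then comes from explicit
  formulas, and compositions and inverses stay in the class without an inverse function
  theorem.\<close>

definition symp_pair ::
  "(real^('n::finite + 'n) \<Rightarrow> real^('n + 'n)) \<Rightarrow> (real^('n + 'n) \<Rightarrow> real^('n + 'n)) \<Rightarrow> bool" where
  "symp_pair h h' \<longleftrightarrow> (\<forall>x. h' (h x) = x) \<and> (\<forall>x. h (h' x) = x) \<and>
     (\<forall>k. Ck_map k h) \<and> (\<forall>k. Ck_map k h') \<and>
     (\<forall>x a b. omega (frechet_derivative h (at x) a) (frechet_derivative h (at x) b) = omega a b)"

lemma Ck_map_has_derivative:
  assumes "\<And>k. Ck_map k f"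
  shows "(f has_derivative frechet_derivative f (at x)) (at x)"
  using Ck_map_SucD(1)[OF assms[of "Suc 0"]] .

lemma frechet_derivative_compose_smooth:
  assumes "\<And>k. Ck_map k f" "\<And>k. Ck_map k g"
  shows "frechet_derivative (\<lambda>x. f (g x)) (at x) a
    = frechet_derivative f (at (g x)) (frechet_derivative g (at x) a)"
  using frechet_derivative_at[OF has_derivative_compose[OF Ck_map_has_derivative[OF assms(2)]
      Ck_map_has_derivative[OF assms(1)]], symmetric] by metis

lemma symp_pair_id: "symp_pair (\<lambda>x. x) (\<lambda>x. x)"
  by (simp add: symp_pair_def Ck_map_id frechet_derivative_ident)

lemma symp_pair_compose:
  assumes "symp_pair f f'" "symp_pair h h'"
  shows "symp_pair (\<lambda>x. f (h x)) (\<lambda>x. h' (f' x))"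
proof -
  have "\<And>k. Ck_map k f" "\<And>k. Ck_map k f'" "\<And>k. Ck_map k h" "\<And>k. Ck_map k h'"
    using assms by (simp_all add: symp_pair_def)
  note this[intro] and frechet_derivative_compose_smooth[OF this(1,3), simp]
  show ?thesis using assms unfolding symp_pair_def by (auto intro: Ck_map_compose)
qed

lemma symp_pair_derivative_inverse:
  assumes "symp_pair h h'"
  shows "frechet_derivative h (at (h' z)) (frechet_derivative h' (at z) a) = a"
proof -
  have "frechet_derivative (\<lambda>x. h (h' x)) (at z) a = a"
    using assms by (simp add: symp_pair_def frechet_derivative_ident)
  then show ?thesis
    using frechet_derivative_compose_smooth[of h h' z a] assms by (simp add: symp_pair_def)
qed

text \<open>The derivative of \<open>h\<close> at \<open>h' z\<close> undoes that of
  \<open>h'\<close> at \<open>z\<close>, so invariance of the form under the one is invariance under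
  the other.\<close>

lemma symp_pair_sym:
  assumes "symp_pair h h'" shows "symp_pair h' h"
proof -
  have "omega (frechet_derivative h' (at z) a) (frechet_derivative h' (at z) b) = omega a b" for z a b
    using assms symp_pair_derivative_inverse[OF assms] unfolding symp_pair_def by metis
  then show ?thesis using assms by (auto simp: symp_pair_def)
qed

lemma symp_pair_translation: "symp_pair (\<lambda>x. x + v) (\<lambda>x. x - v)"
proof -
  have "((\<lambda>x. x + v) has_derivative (\<lambda>x. x)) (at x)" for x
    by (auto intro!: derivative_eq_intros)
  then have "frechet_derivative (\<lambda>x. x + v) (at x) = (\<lambda>x. x)" for x
    using frechet_derivative_at by metis
  then show ?thesis
    by (auto simp: symp_pair_def intro: Ck_map_add Ck_map_diff Ck_map_id Ck_map_const)
qed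

text \<open>Since \<open>omega w w = 0\<close>, the shift does not change \<open>omega x w\<close>,
  so subtracting the same multiple of \<open>w\<close> inverts the map. The derivative adds to
  \<open>a\<close> a multiple of \<open>omega a w\<close> times \<open>w\<close>; in the form the
  two cross terms cancel by antisymmetry.\<close>

lemma symp_pair_transvection:
  assumes g: "\<And>k. Ck_map k (g::real \<Rightarrow> real)"
  shows "symp_pair (\<lambda>x. x + g (omega x w) *\<^sub>R w) (\<lambda>x. x - g (omega x w) *\<^sub>R w)"
proof -
  have gw: "Ck_map k (\<lambda>x. g (omega x w) *\<^sub>R w)" for k
    by (intro Ck_map_scaleR Ck_map_const Ck_map_compose[OF g] Ck_map_linear bounded_linear_omega)
  let ?D = "\<lambda>x. frechet_derivative g (at (omega x w))"
  have der: "((\<lambda>x. x + g (omega x w) *\<^sub>R w) has_derivative (\<lambda>a. a + ?D x (omega a w) *\<^sub>R w)) (at x)" for x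
  proof -
    have "((\<lambda>x. omega x w) has_derivative (\<lambda>a. omega a w)) (at x)"
      by (rule bounded_linear_imp_has_derivative[OF bounded_linear_omega])
    from has_derivative_compose[OF this Ck_map_has_derivative[OF g]]
    have "((\<lambda>x. g (omega x w)) has_derivative (\<lambda>a. ?D x (omega a w))) (at x)" .
    from has_derivative_add[OF has_derivative_ident has_derivative_scaleR_left[OF this, of w]]
    show ?thesis .
  qed
  have fd: "frechet_derivative (\<lambda>x. x + g (omega x w) *\<^sub>R w) (at x) = (\<lambda>a. a + ?D x (omega a w) *\<^sub>R w)" for x
    using frechet_derivative_at[OF der] by simp
  have lin: "?D x r = r * ?D x 1" for x r
    using linear_scale[OF has_derivative_linear[OF Ck_map_has_derivative[OF g]], of "omega x w" r 1] by simp
  have "omega (a + ?D x (omega a w) *\<^sub>R w) (b + ?D x (omega b w) *\<^sub>R w) = omega a b" for x a b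
    using lin[of x "omega a w"] lin[of x "omega b w"] omega_antisym[of w b]
    by (simp add: omega_add_left omega_add_right omega_scale_left omega_scale_right omega_self algebra_simps)
  moreover have "omega (x + c *\<^sub>R w) w = omega x w" "omega (x - c *\<^sub>R w) w = omega x w" for x c
    by (simp_all add: omega_add_left omega_diff_left omega_scale_left omega_self)
  ultimately show ?thesis unfolding symp_pair_def fd
    by (auto intro: Ck_map_add Ck_map_diff Ck_map_id gw)
qed

lemma symp_pair_smooth_diffeomorphism:
  assumes "symp_pair h h'" shows "smooth_diffeomorphism h"
proof -
  have "bij h" using assms by (intro o_bij[of h']) (auto simp: symp_pair_def)
  moreover have "inv h = h'" using assms by (intro inv_unique_comp) (auto simp: symp_pair_def)
  ultimately show ?thesis using assms by (simp add: smooth_diffeomorphism_def symp_pair_def)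
qed

lemma symp_pair_symplectic:
  assumes "symp_pair h h'" shows "symplectic_on UNIV h"
proof -
  have "transpose A ** J_mat ** A = J_mat"
    if A: "A = matrix (frechet_derivative h (at x))" for x A
  proof -
    have lin: "linear (frechet_derivative h (at x))"
      using Ck_map_has_derivative[of h x] assms by (auto simp: symp_pair_def dest: has_derivative_linear)
    have "a \<bullet> ((transpose A ** J_mat ** A) *v b) = a \<bullet> (J_mat *v b)" for a b
    proof -
      have "a \<bullet> ((transpose A ** J_mat ** A) *v b) = (A *v a) \<bullet> (J_mat *v (A *v b))"
        by (simp only: matrix_vector_mul_assoc[symmetric] transpose_matrix_vector
            inner_commute[of a] dot_lmul_matrix) (simp only: inner_commute)
      also have "\<dots> = a \<bullet> (J_mat *v b)"
        using assms unfolding A symp_pair_def omega_def by (simp add: matrix_works[OF lin[folded linear_matrix_vector_mul_eq]])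
      finally show ?thesis .
    qed
    then have "(transpose A ** J_mat ** A) *v b = J_mat *v b" for b
      using vector_eq_ldot by blast
    then show ?thesis by (simp add: matrix_eq)
  qed
  moreover have "h differentiable (at x)" for x
    using Ck_map_has_derivative[of h x] assms unfolding symp_pair_def differentiable_def by blast
  ultimately show ?thesis by (simp add: symplectic_on_def jacobian_def)
qed

text \<open>Translations along \<open>v\<close> are the flow of the linear Hamiltonian
  \<open>omega y v\<close>, and a symplectic change of variables turns a Hamiltonian flow into the
  flow of the pulled-back Hamiltonian.\<close>

lemma conjugate_translation_generated:
  assumes "symp_pair h h'"
  shows "generated_by_hamiltonian (\<lambda>x. h' (h x + v))"
  unfolding generated_by_hamiltonian_def
proof (intro exI conjI allI)
  let ?\<gamma> = "\<lambda>y. omega (h y) v" and ?\<phi> = "\<lambda>x t. h' (h x + t *\<^sub>R v)"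
  have h: "\<And>k. Ck_map k h" "\<And>k. Ck_map k h'" "\<And>x. h' (h x) = x" "\<And>x. h (h' x) = x"
    using assms by (auto simp: symp_pair_def)
  show "Ck_map 1 ?\<gamma>" by (intro Ck_map_linear_comp[OF bounded_linear_omega] h)
  show "?\<phi> x 0 = x" for x by (simp add: h)
  show "h' (h x + v) = ?\<phi> x 1" for x by simp
  have ham: "hamiltonian_vector_field ?\<gamma> y = frechet_derivative h' (at (h y)) v" for y
  proof -
    let ?a = "frechet_derivative h' (at (h y)) v" and ?D = "frechet_derivative h (at y)"
    have der: "(?\<gamma> has_derivative (\<lambda>a. omega (?D a) v)) (at y)"
      by (intro bounded_linear.has_derivative[OF bounded_linear_omega] Ck_map_has_derivative h)
    then have fd: "frechet_derivative ?\<gamma> (at y) = (\<lambda>a. omega (?D a) v)"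
      using frechet_derivative_at by metis
    have lin: "linear (\<lambda>a. omega (?D a) v)" using der has_derivative_linear by blast
    have grad: "(\<chi> i. frechet_derivative ?\<gamma> (at y) (axis i 1)) \<bullet> c = omega (?D c) v" for c
    proof -
      have "omega (?D (\<Sum>i\<in>UNIV. (c $ i) *\<^sub>R axis i 1)) v = (\<Sum>i\<in>UNIV. c $ i * omega (?D (axis i 1)) v)"
        using linear_sum[OF lin, of "\<lambda>i. (c $ i) *\<^sub>R axis i 1" UNIV] linear_scale[OF lin] by simp
      moreover have "(\<Sum>i\<in>UNIV. (c $ i) *\<^sub>R axis i 1) = c"
        using basis_expansion[of c] by (simp add: scalar_mult_eq_scaleR)
      ultimately show ?thesis by (simp add: fd inner_vec_def mult.commute)
    qed
    have "hamiltonian_vector_field ?\<gamma> y \<bullet> b = ?a \<bullet> b" for b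
    proof -
      have "hamiltonian_vector_field ?\<gamma> y \<bullet> b = omega (?D (J_mat *v b)) v"
        unfolding hamiltonian_vector_field_def dot_lmul_matrix by (rule grad)
      \<comment> \<open>Writing \<open>v\<close> as \<open>?D ?a\<close> lets the invariance of the
        form remove \<open>?D\<close> from both arguments.\<close>
      also have "\<dots> = omega (?D (J_mat *v b)) (?D ?a)"
        using symp_pair_derivative_inverse[OF assms, of "h y" v] by (simp add: h)
      also have "\<dots> = omega (J_mat *v b) ?a"
        using assms by (simp add: symp_pair_def)
      also have "\<dots> = ?a \<bullet> b"
        unfolding omega_antisym[of _ ?a] by (simp add: omega_def J_J)
      finally show ?thesis .
    qed
    then show ?thesis using vector_eq_rdot by blast
  qed
  show "(?\<phi> x has_vector_derivative hamiltonian_vector_field ?\<gamma> (?\<phi> x t)) (at t)" for x t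
  proof -
    have "((\<lambda>t. h x + t *\<^sub>R v) has_derivative (\<lambda>t. t *\<^sub>R v)) (at t)"
      by (auto intro!: derivative_eq_intros)
    from has_derivative_compose[OF this Ck_map_has_derivative[OF h(2)]]
    have "(?\<phi> x has_derivative (\<lambda>s. frechet_derivative h' (at (h x + t *\<^sub>R v)) (s *\<^sub>R v))) (at t)" .
    moreover have "linear (frechet_derivative h' (at z))" for z
      using has_derivative_linear[OF Ck_map_has_derivative[OF h(2)]] .
    ultimately show ?thesis
      by (simp add: has_vector_derivative_def ham h linear_scale)
  qed
qed

section \<open>Rearranging cubes\<close>

text \<open>
  \<open>C\<close> is the set of centers of cubes of side \<open>2 * r\<close>, and \<open>p c\<close> is the new center of the cube at \<open>c\<close>.
  The displacement bound \<open>M\<close> is chosen before the slightly smaller cubes of side \<open>2 * \<rho>\<close>.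
\<close>

definition realizable ::
  "real \<Rightarrow> (real^('n::finite + 'n)) set \<Rightarrow> (real^('n + 'n) \<Rightarrow> real^('n + 'n)) \<Rightarrow> bool" where
  "realizable r C p \<longleftrightarrow> (\<exists>M. \<forall>\<rho>. 0 < \<rho> \<and> \<rho> < r \<longrightarrow> (\<exists>h h'. symp_pair h h' \<and>
     (\<forall>x. norm (h x - x) \<le> M) \<and>
     (\<forall>c\<in>C. \<forall>x. (\<forall>k. \<bar>(x - c) $ k\<bar> \<le> \<rho>) \<longrightarrow> h x = x - c + p c)))"

definition l1 :: "real^'n \<Rightarrow> real" where
  "l1 w = (\<Sum>k\<in>UNIV. \<bar>w $ k\<bar>)"

lemma l1_pos: "w \<noteq> 0 \<Longrightarrow> 0 < l1 w"
  unfolding l1_def by (auto simp: vec_eq_iff intro!: sum_pos2)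

lemma l1_axis: "l1 (axis k 1) = 1"
  by (simp add: l1_def axis_def if_distrib[of abs] cong: if_cong)

lemma realizable_initial: "realizable r C (\<lambda>c. c)"
  unfolding realizable_def
  by (intro exI[of _ 0] allI impI exI[of _ "\<lambda>x. x"]) (simp add: symp_pair_id)

text \<open>The cube at \<open>p c\<close> lies in a slab about the level
  \<open>omega (p c) w\<close>, and by \<open>sep\<close> slabs whose cubes receive different
  multiples of \<open>w\<close> are disjoint. A transvection with a profile constant on each slab
  moves every cube rigidly. The bound \<open>A\<close> on the profile comes from \<open>a\<close>
  alone, so the displacement bound is independent of \<open>\<rho>\<close>.\<close>

lemma realizable_step:
  assumes "finite C" "realizable r C p"
    and sep: "\<And>c c'. c \<in> C \<Longrightarrow> c' \<in> C \<Longrightarrow> a c \<noteq> a c' \<Longrightarrow> 2 * r * l1 w \<le> \<bar>omega (p c - p c') w\<bar>"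
  shows "realizable r C (\<lambda>c. p c + a c *\<^sub>R w)"
proof (cases "w = 0")
  case True
  then show ?thesis using assms(2) by simp
next
  case False
  from assms(2) obtain M where M: "\<And>\<rho>. 0 < \<rho> \<Longrightarrow> \<rho> < r \<Longrightarrow> \<exists>h h'. symp_pair h h' \<and>
     (\<forall>x. norm (h x - x) \<le> M) \<and>
     (\<forall>c\<in>C. \<forall>x. (\<forall>k. \<bar>(x - c) $ k\<bar> \<le> \<rho>) \<longrightarrow> h x = x - c + p c)"
    unfolding realizable_def by blast
  define A where "A = (\<Sum>c\<in>C. \<bar>a c\<bar>)"
  have A: "0 \<le> A" "\<And>c. c \<in> C \<Longrightarrow> \<bar>a c\<bar> \<le> A"
    unfolding A_def by (auto intro: sum_nonneg member_le_sum assms(1))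
  show ?thesis unfolding realizable_def
  proof (intro exI[of _ "M + A * norm w"] allI impI)
    fix \<rho> assume \<rho>: "0 < \<rho> \<and> \<rho> < r"
    obtain h h' where h: "symp_pair h h'" "\<And>x. norm (h x - x) \<le> M"
      "\<And>c x. c \<in> C \<Longrightarrow> (\<And>k. \<bar>(x - c) $ k\<bar> \<le> \<rho>) \<Longrightarrow> h x = x - c + p c"
      using M[of \<rho>] \<rho> by blast
    have "\<rho> * l1 w < r * l1 w" using \<rho> l1_pos[OF False] by simp
    from smooth_interpolation[where t = "\<lambda>c. omega (p c) w" and \<alpha> = a, OF assms(1) this A] sep
    obtain g :: "real \<Rightarrow> real" where g: "\<And>k. Ck_map k g" "\<And>x. \<bar>g x\<bar> \<le> A"
      "\<And>c x. c \<in> C \<Longrightarrow> \<bar>x - omega (p c) w\<bar> \<le> \<rho> * l1 w \<Longrightarrow> g x = a c"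
      unfolding omega_diff_left mult.assoc by blast
    define f where "f = (\<lambda>y. y + g (omega y w) *\<^sub>R w)"
    have "symp_pair (\<lambda>x. f (h x)) (\<lambda>x. h' (x - g (omega x w) *\<^sub>R w))"
      unfolding f_def by (rule symp_pair_compose[OF symp_pair_transvection[OF g(1)] h(1)])
    moreover have "norm (f (h x) - x) \<le> M + A * norm w" for x
    proof -
      have "norm (g (omega (h x) w) *\<^sub>R w) \<le> A * norm w" using g(2) by (simp add: mult_right_mono)
      from norm_triangle_mono[OF h(2)[of x] this] show ?thesis by (simp add: f_def algebra_simps)
    qed
    moreover have "f (h x) = x - c + (p c + a c *\<^sub>R w)"
      if "c \<in> C" "\<And>k. \<bar>(x - c) $ k\<bar> \<le> \<rho>" for c x
    proof -
      have hx: "h x = (x - c) + p c" by (rule h(3)[OF that])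
      have "\<bar>omega (x - c) w\<bar> \<le> \<rho> * l1 w"
        using omega_box[OF that(2)] by (simp add: l1_def)
      then have "g (omega (h x) w) = a c"
        by (intro g(3)[OF that(1)]) (simp add: hx omega_add_left)
      then show ?thesis by (simp add: f_def hx)
    qed
    ultimately show "\<exists>h h'. symp_pair h h' \<and> (\<forall>x. norm (h x - x) \<le> M + A * norm w) \<and>
       (\<forall>c\<in>C. \<forall>x. (\<forall>k. \<bar>(x - c) $ k\<bar> \<le> \<rho>) \<longrightarrow> h x = x - c + (p c + a c *\<^sub>R w))"
      by (intro exI[of _ "\<lambda>x. f (h x)"] exI[of _ "\<lambda>x. h' (x - g (omega x w) *\<^sub>R w)"]) blast
  qed
qed

text \<open>Gaps for \<open>omega _ w\<close> permit a shift along \<open>w\<close> by multiples of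
  \<open>code\<close>. Seen through \<open>u\<close>, distinct codes contribute at least
  \<open>H\<close> and the old differences at most \<open>B\<close>, where \<open>H\<close> is
  \<open>B\<close> plus the absolute value of \<open>D\<close>. Thus a gap for one functional is
  traded for gaps of any size for others.\<close>

lemma realizable_separate:
  fixes code :: "real^('n::finite + 'n) \<Rightarrow> nat"
  assumes "finite C" "realizable r C p" "finite F"
    and sep: "\<And>c c'. c \<in> C \<Longrightarrow> c' \<in> C \<Longrightarrow> code c \<noteq> code c' \<Longrightarrow>
      2 * r * l1 w \<le> \<bar>omega (p c - p c') w\<bar>"
    and F: "\<And>u. u \<in> F \<Longrightarrow> \<bar>omega w u\<bar> = 1"
  shows "\<exists>H::real. realizable r C (\<lambda>c. p c + (H * code c) *\<^sub>R w) \<and>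
    (\<forall>c\<in>C. \<forall>c'\<in>C. \<forall>u\<in>F. code c \<noteq> code c' \<longrightarrow>
      D \<le> \<bar>omega ((p c + (H * code c) *\<^sub>R w) - (p c' + (H * code c') *\<^sub>R w)) u\<bar>)"
proof -
  define B where "B = (\<Sum>(c, c', u)\<in>C \<times> C \<times> F. \<bar>omega (p c - p c') u\<bar>)"
  have B: "\<bar>omega (p c - p c') u\<bar> \<le> B" if "c \<in> C" "c' \<in> C" "u \<in> F" for c c' u
    unfolding B_def
    using member_le_sum[of "(c, c', u)" "C \<times> C \<times> F" "\<lambda>(c, c', u). \<bar>omega (p c - p c') u\<bar>"] that assms(1,3)
    by auto
  have "B \<ge> 0" unfolding B_def by (auto intro: sum_nonneg)
  define H where "H = \<bar>D\<bar> + B"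
  have H: "H \<ge> 0" using \<open>B \<ge> 0\<close> by (simp add: H_def)
  have "realizable r C (\<lambda>c. p c + (H * code c) *\<^sub>R w)"
    by (rule realizable_step[OF assms(1,2)]) (use sep in auto)
  moreover have "D \<le> \<bar>omega ((p c + (H * code c) *\<^sub>R w) - (p c' + (H * code c') *\<^sub>R w)) u\<bar>"
    if "c \<in> C" "c' \<in> C" "u \<in> F" "code c \<noteq> code c'" for c c' u
  proof -
    have "1 \<le> \<bar>real (code c) - real (code c')\<bar>" using that(4) by linarith
    then have "H * 1 \<le> H * \<bar>real (code c) - real (code c')\<bar>" using H by (rule mult_left_mono)
    also have "\<dots> = \<bar>H * (real (code c) - real (code c')) * omega w u\<bar>"
      using H F[OF that(3)] by (simp add: abs_mult)
    finally have "H \<le> \<bar>H * (real (code c) - real (code c')) * omega w u\<bar>" by simp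
    moreover have "omega ((p c + (H * code c) *\<^sub>R w) - (p c' + (H * code c') *\<^sub>R w)) u
      = omega (p c - p c') u + H * (real (code c) - real (code c')) * omega w u"
      by (simp add: omega_diff_left omega_add_left omega_scale_left algebra_simps)
    ultimately show ?thesis using B[OF that(1-3)] unfolding H_def by linarith
  qed
  ultimately show ?thesis by blast
qed

definition agree :: "'n set \<Rightarrow> real^'n \<Rightarrow> real^'n \<Rightarrow> bool" where
  "agree K c c' \<longleftrightarrow> (\<forall>k\<in>K. c $ k = c' $ k)"

text \<open>The classes are numbered by naturals because different naturals differ by at least 1,
  which turns a multiple of the code into a gap.\<close>

lemma agree_code:
  assumes "finite C"
  shows "\<exists>code :: real^'n \<Rightarrow> nat. \<forall>c\<in>C. \<forall>c'\<in>C. code c = code c' \<longleftrightarrow> agree K c c'"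
proof -
  define f where "f = (\<lambda>c::real^'n. \<lambda>k. if k \<in> K then c $ k else 0)"
  obtain g :: "_ \<Rightarrow> nat" where g: "inj_on g (f ` C)"
    using finite_imp_inj_to_nat_seg[of "f ` C"] assms by blast
  have "f c = f c' \<longleftrightarrow> agree K c c'" for c c'
    unfolding f_def agree_def by (auto simp: fun_eq_iff)
  moreover have "g (f c) = g (f c') \<longleftrightarrow> f c = f c'" if "c \<in> C" "c' \<in> C" for c c'
    using inj_on_eq_iff[OF g] that by blast
  ultimately show ?thesis by (intro exI[of _ "\<lambda>c. g (f c)"]) simp
qed

lemma abs_omega_ones:
  "\<bar>omega 1 (axis k 1)\<bar> = 1" "\<bar>omega (axis k 1) 1\<bar> = 1"
  using abs_omega_axis[of "1" k] omega_antisym[of "axis k 1" "1"] by auto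

text \<open>
  Cubes that differ in a coordinate of \<open>K\<close> are far apart, the others have not moved relative to each
  other. To add the coordinate \<open>j\<close> to \<open>K\<close>, shift along the axis conjugate to \<open>j\<close> and then along the
  all-ones vector, which pairs to \<open>\<plusminus> 1\<close> with every axis.
\<close>

lemma realizable_spread:
  fixes C :: "(real^('n::finite + 'n)) set"
  assumes "finite C"
    and grid: "\<And>c c' k. c \<in> C \<Longrightarrow> c' \<in> C \<Longrightarrow> c $ k \<noteq> c' $ k \<Longrightarrow> 2 * r \<le> \<bar>c $ k - c' $ k\<bar>"
  shows "\<exists>p. realizable r C p \<and>
    (\<forall>c\<in>C. \<forall>c'\<in>C. agree K c c' \<longrightarrow> p c - c = p c' - c') \<and>
    (\<forall>c\<in>C. \<forall>c'\<in>C. \<not> agree K c c' \<longrightarrow> (\<forall>k. D \<le> \<bar>omega (p c - p c') (axis k 1)\<bar>))"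
  using finite[of K]
proof (induction K arbitrary: D rule: finite_induct)
  case empty
  show ?case by (rule exI[of _ "\<lambda>c. c"]) (simp add: realizable_initial agree_def)
next
  case (insert j K)
  let ?u = "1 :: real^('n + 'n)" and ?e = "axis (conj_index j) 1 :: real^('n + 'n)"
  obtain p where p: "realizable r C p"
    "\<And>c c'. c \<in> C \<Longrightarrow> c' \<in> C \<Longrightarrow> agree K c c' \<Longrightarrow> p c - c = p c' - c'"
    "\<And>c c' k. c \<in> C \<Longrightarrow> c' \<in> C \<Longrightarrow> \<not> agree K c c' \<Longrightarrow> 2 * r \<le> \<bar>omega (p c - p c') (axis k 1)\<bar>"
    using insert.IH[of "2 * r"] by blast
  obtain code :: "real^('n + 'n) \<Rightarrow> nat" where
    code: "\<And>c c'. c \<in> C \<Longrightarrow> c' \<in> C \<Longrightarrow> code c = code c' \<longleftrightarrow> agree (insert j K) c c'"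
    using agree_code[OF assms(1)] by blast
  \<comment> \<open>Two cubes that differ on \<open>K\<close> are apart by the induction hypothesis,
    taken with gap \<open>2 * r\<close>. Two that agree on \<open>K\<close> still have their
    original relative position, where the grid gives a gap in coordinate \<open>j\<close>, the one
    that \<open>?e\<close> reads.\<close>
  have "2 * r * l1 ?e \<le> \<bar>omega (p c - p c') ?e\<bar>" if "c \<in> C" "c' \<in> C" "code c \<noteq> code c'" for c c'
  proof (cases "agree K c c'")
    case False
    then show ?thesis using p(3) that by (simp add: l1_axis)
  next
    case True
    then have "c $ j \<noteq> c' $ j" using that code by (auto simp: agree_def)
    moreover have "p c - p c' = c - c'" using p(2)[OF that(1,2) True] by (simp add: algebra_simps)
    ultimately show ?thesis using grid[OF that(1,2)] by (simp add: l1_axis abs_omega_axis)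
  qed
  from realizable_separate[OF assms(1) p(1), of "{?u}" code ?e "2 * r * l1 ?u", OF _ this]
  obtain H :: real where H: "realizable r C (\<lambda>c. p c + (H * code c) *\<^sub>R ?e)"
    "\<And>c c'. c \<in> C \<Longrightarrow> c' \<in> C \<Longrightarrow> code c \<noteq> code c' \<Longrightarrow>
      2 * r * l1 ?u \<le> \<bar>omega ((p c + (H * code c) *\<^sub>R ?e) - (p c' + (H * code c') *\<^sub>R ?e)) ?u\<bar>"
    by (auto simp: abs_omega_ones)
  \<comment> \<open>The first shift opened gaps for \<open>omega _ ?u\<close>. They permit the shift
    along \<open>?u\<close>, which opens gaps for all axes at once.\<close>
  have "\<bar>omega ?u w\<bar> = 1" if "w \<in> range (\<lambda>k. axis k 1)" for w
    using that by (auto simp: abs_omega_ones)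
  from realizable_separate[OF assms(1) H(1), of "range (\<lambda>k. axis k 1)" code ?u D, OF _ H(2) this]
  obtain H' :: real where H': "realizable r C (\<lambda>c. p c + (H * code c) *\<^sub>R ?e + (H' * code c) *\<^sub>R ?u)"
    "\<And>c c' k. c \<in> C \<Longrightarrow> c' \<in> C \<Longrightarrow> code c \<noteq> code c' \<Longrightarrow>
      D \<le> \<bar>omega ((p c + (H * code c) *\<^sub>R ?e + (H' * code c) *\<^sub>R ?u)
        - (p c' + (H * code c') *\<^sub>R ?e + (H' * code c') *\<^sub>R ?u)) (axis k 1)\<bar>"
    by (auto simp: abs_omega_ones)
  show ?case
  proof (intro exI conjI ballI impI allI)
    show "realizable r C (\<lambda>c. p c + (H * code c) *\<^sub>R ?e + (H' * code c) *\<^sub>R ?u)" by (rule H')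
  next
    fix c c' assume c: "c \<in> C" "c' \<in> C" "agree (insert j K) c c'"
    then have "agree K c c'" by (simp add: agree_def)
    then have "p c - c = p c' - c'" using p(2) c by blast
    moreover have "code c = code c'" using code c by blast
    ultimately show "p c + (H * code c) *\<^sub>R ?e + (H' * code c) *\<^sub>R ?u - c
      = p c' + (H * code c') *\<^sub>R ?e + (H' * code c') *\<^sub>R ?u - c'"
      by (simp add: algebra_simps)
  next
    fix c c' k assume "c \<in> C" "c' \<in> C" "\<not> agree (insert j K) c c'"
    then show "D \<le> \<bar>omega ((p c + (H * code c) *\<^sub>R ?e + (H' * code c) *\<^sub>R ?u)
        - (p c' + (H * code c') *\<^sub>R ?e + (H' * code c') *\<^sub>R ?u)) (axis k 1)\<bar>"
      using H'(2) code by blast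
  qed
qed

text \<open>
  After a huge shift by \<open>H * idx c\<close> along the all-ones vector, the cubes stay apart while their
  remaining bounded offsets are cancelled one coordinate at a time.
\<close>

lemma realizable_line:
  fixes C :: "(real^('n::finite + 'n)) set" and idx :: "real^('n + 'n) \<Rightarrow> nat"
  assumes "finite C" "0 < r" "inj_on idx C"
    and grid: "\<And>c c' k. c \<in> C \<Longrightarrow> c' \<in> C \<Longrightarrow> c $ k \<noteq> c' $ k \<Longrightarrow> 2 * r \<le> \<bar>c $ k - c' $ k\<bar>"
  shows "\<exists>v. realizable r C (\<lambda>c. real (idx c) *\<^sub>R v)"
proof -
  let ?u = "1 :: real^('n + 'n)"
  fix k0 :: "'n + 'n"
  let ?e = "axis k0 1 :: real^('n + 'n)"
  obtain p where p: "realizable r C p"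
    "\<And>c c' k. c \<in> C \<Longrightarrow> c' \<in> C \<Longrightarrow> c \<noteq> c' \<Longrightarrow> 2 * r \<le> \<bar>omega (p c - p c') (axis k 1)\<bar>"
    using realizable_spread[OF assms(1) grid, of UNIV "2 * r"] by (auto simp: agree_def vec_eq_iff)
  have "2 * r * l1 ?e \<le> \<bar>omega (p c - p c') ?e\<bar>" if "c \<in> C" "c' \<in> C" "idx c \<noteq> idx c'" for c c'
    using p(2)[OF that(1,2), of k0] that by (auto simp: l1_axis)
  \<comment> \<open>A shift by multiples of \<open>idx\<close> along one arbitrary axis opens the
    gaps for \<open>omega _ ?u\<close> that the long shift along \<open>?u\<close> requires.\<close>
  from realizable_separate[OF assms(1) p(1), of "{?u}" idx ?e "2 * r * l1 ?u", OF _ this]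
  obtain q where q: "realizable r C q"
    "\<And>c c'. c \<in> C \<Longrightarrow> c' \<in> C \<Longrightarrow> idx c \<noteq> idx c' \<Longrightarrow> 2 * r * l1 ?u \<le> \<bar>omega (q c - q c') ?u\<bar>"
    by (auto simp: abs_omega_ones)
  define B where "B = (\<Sum>c\<in>C. norm (q c))"
  have B: "\<bar>q c $ k\<bar> \<le> B" if "c \<in> C" for c k
    using component_le_norm_cart[of "q c" k] member_le_sum[of c C "\<lambda>c. norm (q c)"] that assms(1)
    by (simp add: B_def)
  \<comment> \<open>Offsets bounded by \<open>B\<close> differ by at most \<open>2 * B\<close>;
    different indices then still leave a gap of \<open>2 * r\<close> in every coordinate.\<close>
  define H where "H = 2 * B + 2 * r"
  have "B \<ge> 0" unfolding B_def by (simp add: sum_nonneg)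
  then have H: "H \<ge> 0" using assms(2) by (simp add: H_def)
  \<comment> \<open>In \<open>Q K\<close> the offsets in the coordinates of \<open>K\<close> are
    already cancelled. Cancelling coordinate \<open>j\<close> is a shift along its axis, for which
    the gap in the conjugate coordinate counts; that gap exists whether or not this coordinate is in
    \<open>K\<close>.\<close>
  define Q where "Q = (\<lambda>K c. (\<chi> k. if k \<in> K then 0 else q c $ k) + (H * idx c) *\<^sub>R ?u)"
  have "realizable r C (Q K)" for K
    using finite[of K]
  proof (induction K rule: finite_induct)
    case empty
    have "(\<chi> k. if k \<in> {} then 0 else q c $ k) = q c" for c by (simp add: vec_eq_iff)
    moreover have "realizable r C (\<lambda>c. q c + (H * idx c) *\<^sub>R ?u)"
      by (rule realizable_step[OF assms(1) q(1)]) (use q(2) in auto)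
    ultimately show ?case by (simp add: Q_def)
  next
    case (insert j K)
    have "realizable r C (\<lambda>c. Q K c + (- q c $ j) *\<^sub>R axis j 1)"
    proof (rule realizable_step[OF assms(1) insert.IH])
      fix c c' assume c: "c \<in> C" "c' \<in> C" "- q c $ j \<noteq> - q c' $ j"
      then have "idx c \<noteq> idx c'" using assms(3) by (auto simp: inj_on_def)
      then have "1 \<le> \<bar>real (idx c) - real (idx c')\<bar>" by linarith
      then have "H * 1 \<le> H * \<bar>real (idx c) - real (idx c')\<bar>" using H by (rule mult_left_mono)
      also have "\<dots> = \<bar>H * (real (idx c) - real (idx c'))\<bar>" using H by (simp add: abs_mult)
      finally have 1: "H \<le> \<bar>H * (real (idx c) - real (idx c'))\<bar>" by simp
      let ?k = "conj_index j"
      have "(Q K c - Q K c') $ ?k = (if ?k \<in> K then 0 else q c $ ?k - q c' $ ?k)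
        + H * (real (idx c) - real (idx c'))"
        by (simp add: Q_def algebra_simps)
      then have "2 * r \<le> \<bar>(Q K c - Q K c') $ ?k\<bar>"
        using 1 B[OF c(1), of ?k] B[OF c(2), of ?k] \<open>B \<ge> 0\<close> unfolding H_def
        by (auto split: if_splits)
      then show "2 * r * l1 (axis j 1) \<le> \<bar>omega (Q K c - Q K c') (axis j 1)\<bar>"
        by (simp add: l1_axis abs_omega_axis)
    qed
    moreover have "Q K c + (- q c $ j) *\<^sub>R axis j 1 = Q (insert j K) c" for c
      using insert.hyps by (auto simp: Q_def vec_eq_iff axis_def)
    ultimately show ?case by simp
  qed
  from this[of UNIV] have "realizable r C (\<lambda>c. (H * idx c) *\<^sub>R ?u)"
    by (simp add: Q_def zero_vec_def[symmetric])
  then show ?thesis by (intro exI[of _ "H *\<^sub>R ?u"]) (simp add: mult.commute)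
qed

lemma symplectic_shuffle:
  fixes C :: "(real^('n::finite + 'n)) set" and idx :: "real^('n + 'n) \<Rightarrow> nat"
  assumes "finite C" "0 < r" "inj_on idx C"
    and grid: "\<And>c c' k. c \<in> C \<Longrightarrow> c' \<in> C \<Longrightarrow> c $ k \<noteq> c' $ k \<Longrightarrow> 2 * r \<le> \<bar>c $ k - c' $ k\<bar>"
  shows "\<exists>M. \<forall>\<rho>. 0 < \<rho> \<and> \<rho> < r \<longrightarrow> (\<exists>S. smooth_diffeomorphism S \<and> symplectic_on UNIV S \<and>
    generated_by_hamiltonian S \<and> (\<forall>x. norm (S x - x) \<le> M) \<and>
    (\<forall>c\<in>C. \<forall>c'\<in>C. idx c' = Suc (idx c) \<longrightarrow>
      (\<forall>x. (\<forall>k. \<bar>(x - c) $ k\<bar> \<le> \<rho>) \<longrightarrow> S x = x - c + c')))"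
proof -
  obtain v where "realizable r C (\<lambda>c. real (idx c) *\<^sub>R v)"
    using realizable_line[OF assms] by blast
  then obtain M where M: "\<And>\<rho>. 0 < \<rho> \<Longrightarrow> \<rho> < r \<Longrightarrow> \<exists>h h'. symp_pair h h' \<and>
     (\<forall>x. norm (h x - x) \<le> M) \<and>
     (\<forall>c\<in>C. \<forall>x. (\<forall>k. \<bar>(x - c) $ k\<bar> \<le> \<rho>) \<longrightarrow> h x = x - c + real (idx c) *\<^sub>R v)"
    unfolding realizable_def by blast
  show ?thesis
  proof (intro exI[of _ "2 * M + norm v"] allI impI)
    fix \<rho> assume \<rho>: "0 < \<rho> \<and> \<rho> < r"
    obtain h h' where h: "symp_pair h h'" "\<And>x. norm (h x - x) \<le> M"
      "\<And>c x. c \<in> C \<Longrightarrow> (\<And>k. \<bar>(x - c) $ k\<bar> \<le> \<rho>) \<Longrightarrow> h x = x - c + real (idx c) *\<^sub>R v"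
      using M[of \<rho>] \<rho> by blast
    define S where "S = (\<lambda>x. h' (h x + v))"
    have inv: "h' (h x) = x" "h (h' x) = x" for x using h(1) by (auto simp: symp_pair_def)
    have "symp_pair S (\<lambda>x. h' (h x - v))"
      unfolding S_def
      using symp_pair_compose[OF symp_pair_sym[OF h(1)] symp_pair_compose[OF symp_pair_translation h(1)]] .
    then have "smooth_diffeomorphism S" "symplectic_on UNIV S"
      by (auto intro: symp_pair_smooth_diffeomorphism symp_pair_symplectic)
    moreover have "generated_by_hamiltonian S"
      unfolding S_def by (rule conjugate_translation_generated[OF h(1)])
    moreover have "norm (S x - x) \<le> 2 * M + norm v" for x
    proof -
      \<comment> \<open>As \<open>h (S x) = h x + v\<close>, the displacement of \<open>h'\<close>
        is expressed by that of \<open>h\<close> at \<open>S x\<close>.\<close>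
      have "S x - x = (h x - x) + v - (h (S x) - S x)" by (simp add: S_def inv)
      also have "norm \<dots> \<le> norm (h x - x) + norm v + norm (h (S x) - S x)"
        by (meson norm_triangle_ineq norm_triangle_ineq4 add_mono order_refl order_trans)
      finally show ?thesis using h(2)[of x] h(2)[of "S x"] by linarith
    qed
    moreover have "S x = x - c + c'"
      if "c \<in> C" "c' \<in> C" "idx c' = Suc (idx c)" "\<And>k. \<bar>(x - c) $ k\<bar> \<le> \<rho>" for c c' x
    proof -
      \<comment> \<open>The translated point lies in the cube of \<open>c'\<close>, where
        \<open>h\<close> is a known translation too.\<close>
      have "h (x - c + c') = (x - c + c') - c' + real (idx c') *\<^sub>R v"
        using that(4) by (intro h(3)[OF that(2)]) simp
      also have "\<dots> = h x + v"
        using h(3)[OF that(1,4)] that(3) by (simp add: algebra_simps)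
      finally show ?thesis unfolding S_def by (metis inv(1))
    qed
    ultimately show "\<exists>S. smooth_diffeomorphism S \<and> symplectic_on UNIV S \<and>
      generated_by_hamiltonian S \<and> (\<forall>x. norm (S x - x) \<le> 2 * M + norm v) \<and>
      (\<forall>c\<in>C. \<forall>c'\<in>C. idx c' = Suc (idx c) \<longrightarrow>
        (\<forall>x. (\<forall>k. \<bar>(x - c) $ k\<bar> \<le> \<rho>) \<longrightarrow> S x = x - c + c'))"
      by blast
  qed
qed

section \<open>Ordering the cells of a grid\<close>

text \<open>Injections of \<open>E b\<close> into \<open>F b\<close> glue to one injection, both
  families being disjoint. What is left of \<open>T\<close> on the two sides has equal size, so an
  arbitrary bijection completes it to a permutation.\<close>

lemma matching_permutation:
  assumes "finite T" "finite I"
    and E: "\<And>b. b \<in> I \<Longrightarrow> E b \<subseteq> T" "disjoint_family_on E I"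
    and F: "\<And>b. b \<in> I \<Longrightarrow> F b \<subseteq> T" "disjoint_family_on F I"
    and card: "\<And>b. b \<in> I \<Longrightarrow> card (E b) \<le> card (F b)"
  shows "\<exists>f. bij_betw f T T \<and> (\<forall>b\<in>I. f ` E b \<subseteq> F b)"
proof -
  have fin: "finite (E b)" "finite (F b)" if "b \<in> I" for b
    using finite_subset[OF E(1)[OF that] assms(1)] finite_subset[OF F(1)[OF that] assms(1)] by auto
  have "\<forall>b\<in>I. \<exists>g. inj_on g (E b) \<and> g ` E b \<subseteq> F b"
    using card fin by (meson card_le_inj)
  then obtain g where g: "\<And>b. b \<in> I \<Longrightarrow> inj_on (g b) (E b)" "\<And>b. b \<in> I \<Longrightarrow> g b ` E b \<subseteq> F b"
    by metis
  define \<beta> where "\<beta> m = (SOME b. b \<in> I \<and> m \<in> E b)" for m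
  have \<beta>: "\<beta> m = b" if "b \<in> I" "m \<in> E b" for m b
  proof -
    have "\<beta> m \<in> I \<and> m \<in> E (\<beta> m)" unfolding \<beta>_def using that by (intro someI) auto
    then show ?thesis using E(2) that unfolding disjoint_family_on_def by blast
  qed
  define D where "D = (\<Union>b\<in>I. E b)"
  define h where "h m = g (\<beta> m) m" for m
  have h: "h m \<in> F b" "h m = g b m" if "b \<in> I" "m \<in> E b" for m b
    using g(2)[OF that(1)] that by (auto simp: h_def \<beta>)
  have "inj_on h D"
  proof (rule inj_onI)
    fix m m' assume "m \<in> D" "m' \<in> D" and eq: "h m = h m'"
    then obtain b b' where b: "b \<in> I" "m \<in> E b" "b' \<in> I" "m' \<in> E b'" by (auto simp: D_def)
    have "b = b'" using h(1)[OF b(1,2)] h(1)[OF b(3,4)] eq F(2) b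
      unfolding disjoint_family_on_def by fastforce
    then show "m = m'" using g(1)[OF b(1)] b eq h(2) by (metis inj_onD)
  qed
  have "D \<subseteq> T" using E(1) by (auto simp: D_def)
  have "h ` D \<subseteq> T" using h(1) F(1) by (auto simp: D_def)
  have "card (T - D) = card (T - h ` D)"
    using \<open>D \<subseteq> T\<close> \<open>h ` D \<subseteq> T\<close> assms(1) \<open>inj_on h D\<close>
    by (simp add: card_Diff_subset finite_subset card_image)
  then obtain k where k: "bij_betw k (T - D) (T - h ` D)"
    using assms(1) by (metis finite_Diff finite_same_card_bij)
  define f where "f m = (if m \<in> D then h m else k m)" for m
  have 1: "bij_betw f D (h ` D)"
    using \<open>inj_on h D\<close> by (subst bij_betw_cong[where g = h]) (auto simp: f_def bij_betw_def)
  have 2: "bij_betw f (T - D) (T - h ` D)"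
    using k by (subst bij_betw_cong[where g = k]) (auto simp: f_def)
  have "bij_betw f (D \<union> (T - D)) (h ` D \<union> (T - h ` D))"
    by (rule bij_betw_combine[OF 1 2]) blast
  then have "bij_betw f T T" using \<open>D \<subseteq> T\<close> \<open>h ` D \<subseteq> T\<close> by (simp add: Un_absorb1)
  moreover have "f ` E b \<subseteq> F b" if "b \<in> I" for b
    using h(1)[OF that] that by (auto simp: f_def D_def)
  ultimately show ?thesis by blast
qed

text \<open>
  Point number \<open>j\<close> of the fibre over \<open>(f ^^ j) a\<close> gets the index \<open>lab a * M + j\<close>;
  \<open>L\<close> collects the last points of the fibres.
\<close>

lemma chain_order:
  fixes \<pi> :: "'b \<Rightarrow> 'a"
  assumes "finite T" "finite T'" "\<pi> ` T' \<subseteq> T"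
    and fibre: "\<And>t. t \<in> T \<Longrightarrow> card {\<tau> \<in> T'. \<pi> \<tau> = t} = M"
    and f: "bij_betw f T T" and "0 < M"
  shows "\<exists>idx L. bij_betw idx T' {..<card T * M} \<and> L \<subseteq> T' \<and> card L \<le> card T \<and>
    (\<forall>\<tau>\<in>T' - L. \<exists>\<tau>'\<in>T'. idx \<tau>' = Suc (idx \<tau>) \<and> \<pi> \<tau>' = f (\<pi> \<tau>))"
proof -
  have "\<exists>e. bij_betw e {\<tau> \<in> T'. \<pi> \<tau> = t} {..<M}" if "t \<in> T" for t
    using finite_same_card_bij[of "{\<tau> \<in> T'. \<pi> \<tau> = t}" "{..<M}"] fibre[OF that] assms(2) by simp
  then obtain e where e: "\<And>t. t \<in> T \<Longrightarrow> bij_betw (e t) {\<tau> \<in> T'. \<pi> \<tau> = t} {..<M}" by metis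
  obtain lab where lab: "bij_betw lab T {..<card T}"
    using ex_bij_betw_finite_nat[OF assms(1)] by (auto simp: atLeast0LessThan)
  define g where "g = inv_into T f"
  have g: "bij_betw g T T" unfolding g_def by (rule bij_betw_inv_into[OF f])
  have gn: "bij_betw (g ^^ j) T T" for j
    by (rule bij_betw_funpow[OF g])
  have gf: "g (f t) = t" if "t \<in> T" for t
    using that f by (simp add: g_def bij_betw_inv_into_left)
  define j where "j \<tau> = e (\<pi> \<tau>) \<tau>" for \<tau>
  have pi: "\<pi> \<tau> \<in> T" if "\<tau> \<in> T'" for \<tau> using assms(3) that by blast
  have j: "j \<tau> < M" if "\<tau> \<in> T'" for \<tau>
    using bij_betw_apply[OF e[OF pi[OF that]], of \<tau>] that by (simp add: j_def)
  have j_inj: "\<tau> = \<tau>'" if "\<tau> \<in> T'" "\<tau>' \<in> T'" "\<pi> \<tau> = \<pi> \<tau>'" "j \<tau> = j \<tau>'" for \<tau> \<tau>'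
    using bij_betw_imp_inj_on[OF e[OF pi[OF that(1)]]] that by (auto simp: j_def inj_on_def)
  \<comment> \<open>The power of \<open>g\<close> goes back to the start of the chain. Since
    \<open>j \<tau> < M\<close>, quotient and remainder by \<open>M\<close> recover the chain and
    the position.\<close>
  define idx where "idx \<tau> = lab ((g ^^ j \<tau>) (\<pi> \<tau>)) * M + j \<tau>" for \<tau>
  have in_T: "(g ^^ n) t \<in> T" if "t \<in> T" for n t using gn that bij_betw_apply by metis
  have idx_eq: "\<pi> \<tau> = \<pi> \<tau>' \<and> j \<tau> = j \<tau>'"
    if "\<tau> \<in> T'" "t \<in> T" "i < M" "idx \<tau> = lab ((g ^^ i) t) * M + i" "\<pi> \<tau>' = t" "j \<tau>' = i" for \<tau> \<tau>' t i
  proof -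
    have "idx \<tau> mod M = j \<tau>" "idx \<tau> div M = lab ((g ^^ j \<tau>) (\<pi> \<tau>))"
      using j[OF that(1)] by (simp_all add: idx_def)
    moreover have "idx \<tau> mod M = i" "idx \<tau> div M = lab ((g ^^ i) t)"
      using that(3) by (simp_all add: that(4))
    ultimately have "j \<tau> = i" "lab ((g ^^ i) (\<pi> \<tau>)) = lab ((g ^^ i) t)" by auto
    then have "(g ^^ i) (\<pi> \<tau>) = (g ^^ i) t"
      using lab in_T pi[OF that(1)] that(2) by (meson bij_betw_imp_inj_on inj_onD)
    then have "\<pi> \<tau> = t"
      using gn pi[OF that(1)] that(2) by (meson bij_betw_imp_inj_on inj_onD)
    then show ?thesis using \<open>j \<tau> = i\<close> that by simp
  qed
  have inj: "inj_on idx T'"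
  proof (rule inj_onI)
    fix \<tau> \<tau>' assume "\<tau> \<in> T'" "\<tau>' \<in> T'" "idx \<tau> = idx \<tau>'"
    then show "\<tau> = \<tau>'" using idx_eq[of \<tau> "\<pi> \<tau>'" "j \<tau>'" \<tau>'] j pi j_inj by (auto simp: idx_def[of \<tau>'])
  qed
  have "idx ` T' \<subseteq> {..<card T * M}"
  proof safe
    fix \<tau> assume \<tau>: "\<tau> \<in> T'"
    have "lab ((g ^^ j \<tau>) (\<pi> \<tau>)) < card T"
      using bij_betw_apply[OF lab in_T[OF pi[OF \<tau>]]] by simp
    then have "Suc (lab ((g ^^ j \<tau>) (\<pi> \<tau>))) * M \<le> card T * M" by (intro mult_right_mono) auto
    then show "idx \<tau> < card T * M" using j[OF \<tau>] by (simp add: idx_def)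
  qed
  moreover have "card T' = card T * M"
  proof -
    have "T' = (\<Union>t\<in>T. {\<tau> \<in> T'. \<pi> \<tau> = t})" using pi by auto
    then have "card T' = (\<Sum>t\<in>T. card {\<tau> \<in> T'. \<pi> \<tau> = t})"
      using card_UN_disjoint[of T "\<lambda>t. {\<tau> \<in> T'. \<pi> \<tau> = t}"] assms(1,2) by auto
    then show ?thesis using fibre by simp
  qed
  ultimately have "idx ` T' = {..<card T * M}"
    using inj by (intro card_subset_eq) (auto simp: card_image)
  then have bij: "bij_betw idx T' {..<card T * M}" using inj by (simp add: bij_betw_def)
  define L where "L = {\<tau> \<in> T'. Suc (j \<tau>) = M}"
  \<comment> \<open>Each fibre has only one point in position \<open>M - 1\<close>.\<close>
  have "inj_on \<pi> L" using j_inj by (intro inj_onI) (auto simp: L_def)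
  then have "card L \<le> card T" using pi assms(1) by (intro card_inj_on_le[of \<pi>]) (auto simp: L_def)
  moreover have "\<exists>\<tau>'\<in>T'. idx \<tau>' = Suc (idx \<tau>) \<and> \<pi> \<tau>' = f (\<pi> \<tau>)"
    if "\<tau> \<in> T' - L" for \<tau>
  proof -
    have t: "\<pi> \<tau> \<in> T" "Suc (j \<tau>) < M" using that pi[of \<tau>] j[of \<tau>] by (auto simp: L_def)
    have ft: "f (\<pi> \<tau>) \<in> T" using f t(1) bij_betw_apply by metis
    then have "Suc (j \<tau>) \<in> e (f (\<pi> \<tau>)) ` {\<sigma> \<in> T'. \<pi> \<sigma> = f (\<pi> \<tau>)}"
      using bij_betw_imp_surj_on[OF e[OF ft]] t(2) by simp
    then obtain \<sigma> where \<sigma>: "\<sigma> \<in> T'" "\<pi> \<sigma> = f (\<pi> \<tau>)" "j \<sigma> = Suc (j \<tau>)" by (auto simp: j_def)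
    \<comment> \<open>Moving to the fibre over \<open>f (\<pi> \<tau>)\<close> and one position up
      leaves the start of the chain, hence the label, unchanged.\<close>
    have "(g ^^ Suc (j \<tau>)) (f (\<pi> \<tau>)) = (g ^^ j \<tau>) (\<pi> \<tau>)"
      by (simp add: funpow_swap1 gf[OF t(1)] del: funpow.simps(2) add: funpow_Suc_right)
    then have "idx \<sigma> = Suc (idx \<tau>)" by (simp add: idx_def \<sigma>)
    then show ?thesis using \<sigma> by blast
  qed
  ultimately show ?thesis using bij by (intro exI[of _ idx] exI[of _ L]) (auto simp: L_def)
qed

section \<open>Grids of half-open cubes and their subdivision\<close>

definition cell_index :: "real \<Rightarrow> real^'n \<Rightarrow> int^'n" where
  "cell_index q x = (\<chi> k. \<lfloor>x $ k / q\<rfloor>)"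

text \<open>The cubes are half-open, so that those of one size partition the space exactly.\<close>

definition cell :: "real \<Rightarrow> int^'n \<Rightarrow> (real^'n) set" where
  "cell q m = {x. cell_index q x = m}"

definition cell_center :: "real \<Rightarrow> int^'n \<Rightarrow> real^'n" where
  "cell_center q m = (\<chi> k. q * (of_int (m $ k) + 1 / 2))"

text \<open>\<open>div\<close> on integers rounds down for negative indices too, so the subcubes of
  side \<open>q / k\<close> are grouped correctly on both sides of 0.\<close>

definition coarse :: "nat \<Rightarrow> int^'n \<Rightarrow> int^'n" where
  "coarse k m = (\<chi> i. m $ i div int k)"

lemma mem_cell:
  assumes "0 < q"
  shows "x \<in> cell q m \<longleftrightarrow> (\<forall>k. q * of_int (m $ k) \<le> x $ k \<and> x $ k < q * (of_int (m $ k) + 1))"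
  using assms by (simp add: cell_def cell_index_def vec_eq_iff floor_eq_iff field_simps)

lemma cell_index_center: "0 < q \<Longrightarrow> cell_index q (cell_center q m) = m"
  by (simp add: cell_index_def cell_center_def vec_eq_iff floor_eq_iff)

lemma cell_diameter:
  fixes x :: "real^'n" and q :: real
  assumes "0 < q" "x \<in> cell q m" "y \<in> cell q m" shows "norm (x - y) \<le> CARD('n) * q"
proof -
  have "\<bar>(x - y) $ k\<bar> \<le> q" for k
  proof -
    have "q * of_int (m $ k) \<le> x $ k" "x $ k < q * (of_int (m $ k) + 1)"
      "q * of_int (m $ k) \<le> y $ k" "y $ k < q * (of_int (m $ k) + 1)"
      using assms(2,3) unfolding mem_cell[OF assms(1)] by auto
    moreover have "(x - y) $ k = x $ k - y $ k" by simp
    ultimately show ?thesis by (simp only: distrib_left)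
  qed
  then have "(\<Sum>k\<in>UNIV. \<bar>(x - y) $ k\<bar>) \<le> (\<Sum>k\<in>(UNIV::'n set). q)" by (intro sum_mono) auto
  then show ?thesis using norm_le_l1_cart[of "x - y"] by simp
qed

lemma cell_index_coarse: "0 < k \<Longrightarrow> coarse k (cell_index (q / real k) x) = cell_index q x"
  using floor_divide_real_eq_div[of "int k" "x $ i / (q / real k)" for i]
  by (simp add: coarse_def cell_index_def vec_eq_iff)

lemma cell_measurable [measurable]: "cell q m \<in> sets borel"
  and cell_measure: "0 < q \<Longrightarrow> measure lebesgue (cell q (m :: int^'n)) = q ^ CARD('n)"
proof -
  have "{x \<in> space borel. \<forall>k. \<lfloor>(x::real^'n) $ k / q\<rfloor> = m $ k} \<in> sets borel" by measurable
  then show meas: "cell q m \<in> sets borel" by (simp add: cell_def cell_index_def vec_eq_iff)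
  assume q: "0 < q"
  define a b :: "real^'n" where "a = (\<chi> k. q * of_int (m $ k))" and "b = (\<chi> k. q * (of_int (m $ k) + 1))"
  have sub: "box a b \<subseteq> cell q m" "cell q m \<subseteq> cbox a b"
    by (auto simp: mem_cell[OF q] mem_box_cart a_def b_def less_imp_le)
  have ne: "cbox a b \<noteq> {}" using q by (auto simp: interval_ne_empty_cart a_def b_def)
  have c: "measure lebesgue (cbox a b) = q ^ CARD('n)"
    using content_cbox_cart[OF ne] by (simp add: a_def b_def algebra_simps)
  have "measure lebesgue (box a b) = measure lebesgue (cbox a b)"
    by (simp add: measure_completion measure_lborel_box_eq measure_lborel_cbox_eq)
  moreover have "measure lebesgue (box a b) \<le> measure lebesgue (cell q m)"
    using sub meas by (intro measure_mono_fmeasurable fmeasurableI2[OF lmeasurable_cbox]) auto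
  moreover have "measure lebesgue (cell q m) \<le> measure lebesgue (cbox a b)"
    using sub meas by (intro measure_mono_fmeasurable) auto
  ultimately show "measure lebesgue (cell q m) = q ^ CARD('n)" using c by simp
qed

lemma cell_lmeasurable:
  fixes m :: "int^'n"
  assumes "0 < q" shows "cell q m \<in> lmeasurable"
proof (rule bounded_set_imp_lmeasurable)
  have "dist (cell_center q m) y \<le> CARD('n) * q" if "y \<in> cell q m" for y
    using cell_diameter[OF assms _ that, of "cell_center q m"] cell_index_center[OF assms, of m]
    by (simp add: cell_def dist_norm)
  then show "bounded (cell q m)" unfolding bounded_def by blast
  show "cell q m \<in> sets lebesgue" using cell_measurable[of q m] by (simp add: sets_completionI_sets)
qed

lemma measure_cells:
  fixes E :: "(int^'n) set" and q :: real
  assumes "0 < q" "finite E"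
  shows "(\<Union>m\<in>E. cell q m) \<in> lmeasurable" "measure lebesgue (\<Union>m\<in>E. cell q m) = card E * q ^ CARD('n)"
proof -
  show "(\<Union>m\<in>E. cell q m) \<in> lmeasurable"
    using assms by (intro fmeasurable.finite_UN) (auto intro: cell_lmeasurable)
  have "disjoint_family_on (cell q) E" by (auto simp: disjoint_family_on_def cell_def)
  then have "measure lebesgue (\<Union>m\<in>E. cell q m) = (\<Sum>m\<in>E. measure lebesgue (cell q m))"
    using fmeasurableD[OF cell_lmeasurable[OF assms(1)]] fmeasurableD2[OF cell_lmeasurable[OF assms(1)]]
    unfolding infinity_ennreal_def[symmetric] by (intro measure_finite_Union[OF assms(2)]) blast+
  then show "measure lebesgue (\<Union>m\<in>E. cell q m) = card E * q ^ CARD('n)"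
    by (simp add: cell_measure[OF assms(1)])
qed

lemma vec_product_finite_card:
  fixes A :: "'n::finite \<Rightarrow> int set"
  assumes "\<And>k. finite (A k)"
  shows "finite {m :: int^'n. \<forall>k. m $ k \<in> A k}" "card {m :: int^'n. \<forall>k. m $ k \<in> A k} = (\<Prod>k\<in>UNIV. card (A k))"
proof -
  have eq: "{m :: int^'n. \<forall>k. m $ k \<in> A k} = vec_lambda ` (Pi\<^sub>E UNIV A)"
  proof safe
    fix m :: "int^'n" assume "\<forall>k. m $ k \<in> A k"
    then have "vec_nth m \<in> Pi\<^sub>E UNIV A" by (auto simp: PiE_def)
    then show "m \<in> vec_lambda ` (Pi\<^sub>E UNIV A)" by (metis image_eqI vec_nth_inverse)
  qed (auto simp: PiE_def)
  have inj: "inj_on (vec_lambda :: _ \<Rightarrow> int^'n) (Pi\<^sub>E UNIV A)"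
    by (rule inj_onI) (metis UNIV_I vec_lambda_inverse)
  show "finite {m :: int^'n. \<forall>k. m $ k \<in> A k}" unfolding eq by (intro finite_imageI finite_PiE) (auto simp: assms)
  show "card {m :: int^'n. \<forall>k. m $ k \<in> A k} = (\<Prod>k\<in>UNIV. card (A k))"
    unfolding eq by (simp add: card_image[OF inj] card_PiE)
qed

lemma coarse_fibre:
  fixes b :: "int^'n"
  assumes "0 < k"
  shows "finite {m. coarse k m = b}" "card {m. coarse k m = b} = k ^ CARD('n)"
proof -
  have "n div int k = c \<longleftrightarrow> n \<in> {int k * c..<int k * c + int k}" for n c
  proof
    assume "n div int k = c"
    then have "n = int k * c + n mod int k" using mult_div_mod_eq[of "int k" n] by simp
    moreover have "0 \<le> n mod int k" "n mod int k < int k" using assms by auto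
    ultimately show "n \<in> {int k * c..<int k * c + int k}" by (simp only: atLeastLessThan_iff) linarith
  next
    assume "n \<in> {int k * c..<int k * c + int k}"
    then show "n div int k = c" by (intro int_div_pos_eq[where r = "n - int k * c"]) auto
  qed
  then have eq: "{m. coarse k m = b} = {m. \<forall>i. m $ i \<in> {int k * b $ i..<int k * b $ i + int k}}"
    by (simp add: coarse_def vec_eq_iff)
  show "finite {m. coarse k m = b}" "card {m. coarse k m = b} = k ^ CARD('n)"
    unfolding eq by (subst vec_product_finite_card; simp)+
qed

lemma finite_cell_index:
  fixes Z :: "(real^'n) set"
  assumes "bounded Z" "0 < q" shows "finite (cell_index q ` Z)"
proof -
  obtain B where B: "\<And>x. x \<in> Z \<Longrightarrow> norm x \<le> B" using assms(1) bounded_iff by metis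
  have "cell_index q ` Z \<subseteq> {m. \<forall>k. m $ k \<in> {\<lfloor>- B / q\<rfloor>..\<lfloor>B / q\<rfloor>}}"
  proof safe
    fix x k assume "x \<in> Z"
    then have "\<bar>x $ k\<bar> \<le> B" using B component_le_norm_cart order_trans by blast
    then have "- B / q \<le> x $ k / q" "x $ k / q \<le> B / q" using assms(2) by (auto simp: field_simps)
    then show "cell_index q x $ k \<in> {\<lfloor>- B / q\<rfloor>..\<lfloor>B / q\<rfloor>}"
      by (simp add: cell_index_def floor_mono)
  qed
  then show ?thesis using vec_product_finite_card(1)[of "\<lambda>_. {\<lfloor>- B / q\<rfloor>..\<lfloor>B / q\<rfloor>}"] finite_subset by blast
qed

section \<open>Approximation by cells\<close>

text \<open>By regularity \<open>A b\<close> is nearly filled by a compact \<open>K b\<close>, and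
  \<open>K b\<close> has an open neighborhood hardly larger than \<open>A b\<close> in volume that
  avoids the other compact sets. Small enough cells that meet \<open>K b\<close> lie in this
  neighborhood, hence belong to one \<open>b\<close> only, and comparing volumes bounds their
  number.\<close>

lemma compact_cell_approximation:
  fixes A :: "'b \<Rightarrow> (real^'n) set"
  assumes "finite I" "disjoint_family_on A I" "0 < \<zeta>"
    and A: "\<And>b. b \<in> I \<Longrightarrow> A b \<in> sets lebesgue" "\<And>b. b \<in> I \<Longrightarrow> bounded (A b)"
  shows "\<exists>d>0. \<exists>K. (\<forall>b\<in>I. K b \<subseteq> A b \<and> compact (K b) \<and> measure lebesgue (A b - K b) \<le> \<zeta>) \<and>
    (\<forall>q::real. 0 < q \<and> CARD('n) * q < d \<longrightarrow>
      disjoint_family_on (\<lambda>b. cell_index q ` K b) I \<and>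
      (\<forall>b\<in>I. finite (cell_index q ` K b) \<and>
        card (cell_index q ` K b) * q ^ CARD('n) \<le> measure lebesgue (A b) + \<zeta>))"
proof -
  have "\<exists>K. K \<subseteq> A b \<and> compact K \<and> measure lebesgue (A b - K) \<le> \<zeta>" if b: "b \<in> I" for b
  proof -
    obtain K where K: "closed K" "K \<subseteq> A b" "A b - K \<in> lmeasurable" "emeasure lebesgue (A b - K) < ennreal \<zeta>"
      using sets_lebesgue_inner_closed[OF A(1)[OF b] assms(3)] by metis
    have "compact K" using K(1,2) A(2)[OF b] bounded_subset compact_eq_bounded_closed by blast
    moreover have "measure lebesgue (A b - K) \<le> \<zeta>"
      using K(3,4) assms(3) by (simp add: emeasure_eq_measure2 ennreal_less_iff)
    ultimately show ?thesis using K(2) by blast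
  qed
  then obtain K where K: "\<And>b. b \<in> I \<Longrightarrow> K b \<subseteq> A b" "\<And>b. b \<in> I \<Longrightarrow> compact (K b)"
    "\<And>b. b \<in> I \<Longrightarrow> measure lebesgue (A b - K b) \<le> \<zeta>" by metis
  have disj: "K b \<inter> K b' = {}" if "b \<in> I" "b' \<in> I" "b \<noteq> b'" for b b'
    using assms(2) K(1) that unfolding disjoint_family_on_def by blast
  define P where "P b V e \<longleftrightarrow> 0 < e \<and> (\<Union>x\<in>K b. ball x e) \<subseteq> V \<and> V \<in> lmeasurable \<and>
      measure lebesgue V \<le> measure lebesgue (A b) + \<zeta> \<and> (\<forall>b'\<in>I. b' \<noteq> b \<longrightarrow> V \<inter> K b' = {})" for b V e
  have "\<exists>V e. P b V e" if b: "b \<in> I" for b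
  proof -
    have Kb: "K b \<in> lmeasurable" by (rule lmeasurable_compact[OF K(2)[OF b]])
    then have "K b \<in> sets lebesgue" by (rule fmeasurableD)
    then obtain W where W: "open W" "K b \<subseteq> W" "W - K b \<in> lmeasurable"
      "emeasure lebesgue (W - K b) < ennreal \<zeta>"
      using sets_lebesgue_outer_open[of "K b" \<zeta>] assms(3) by metis
    define V where "V = W - (\<Union>b'\<in>I - {b}. K b')"
    have "closed (\<Union>b'\<in>I - {b}. K b')"
      using assms(1) K(2) by (intro closed_UN) (auto simp: compact_imp_closed)
    then have "open V" unfolding V_def using W(1) by (rule open_Diff[rotated])
    moreover have "K b \<subseteq> V" using W(2) disj[OF b] by (auto simp: V_def)
    ultimately obtain e where e: "e > 0" "(\<Union>x\<in>K b. ball x e) \<subseteq> V"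
      using compact_subset_open_imp_ball_epsilon_subset[OF K(2)[OF b]] by metis
    have W_eq: "W = K b \<union> (W - K b)" using W(2) by blast
    have Wm: "W \<in> lmeasurable" using fmeasurable.Un[OF Kb W(3)] W_eq by simp
    have "measure lebesgue W \<le> measure lebesgue (K b) + measure lebesgue (W - K b)"
      using measure_Un_le[of "K b" lebesgue "W - K b"] W_eq Kb W(3) by (simp add: fmeasurableD)
    moreover have "measure lebesgue (W - K b) \<le> \<zeta>"
      using W(3,4) assms(3) by (simp add: emeasure_eq_measure2 ennreal_less_iff)
    moreover have Am: "A b \<in> lmeasurable"
      using A b bounded_set_imp_lmeasurable by blast
    then have "measure lebesgue (K b) \<le> measure lebesgue (A b)"
      using K(1)[OF b] Kb by (intro measure_mono_fmeasurable) (auto simp: fmeasurableD)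
    moreover have Vs: "V \<in> sets lebesgue" using borel_open[OF \<open>open V\<close>] by simp
    then have "measure lebesgue V \<le> measure lebesgue W"
      using Wm by (intro measure_mono_fmeasurable) (auto simp: V_def)
    ultimately have "measure lebesgue V \<le> measure lebesgue (A b) + \<zeta>" by linarith
    moreover have "V \<in> lmeasurable" by (rule fmeasurableI2[OF Wm _ Vs]) (auto simp: V_def)
    moreover have "V \<inter> K b' = {}" if "b' \<in> I" "b' \<noteq> b" for b' using that by (auto simp: V_def)
    ultimately show ?thesis using e unfolding P_def by blast
  qed
  then obtain V e where "\<And>b. b \<in> I \<Longrightarrow> P b (V b) (e b)" by metis
  then have V: "\<And>b. b \<in> I \<Longrightarrow> 0 < e b" "\<And>b. b \<in> I \<Longrightarrow> (\<Union>x\<in>K b. ball x (e b)) \<subseteq> V b"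
    "\<And>b. b \<in> I \<Longrightarrow> V b \<in> lmeasurable" "\<And>b. b \<in> I \<Longrightarrow> measure lebesgue (V b) \<le> measure lebesgue (A b) + \<zeta>"
    "\<And>b b'. b \<in> I \<Longrightarrow> b' \<in> I \<Longrightarrow> b' \<noteq> b \<Longrightarrow> V b \<inter> K b' = {}" unfolding P_def by blast+
  define d where "d = Min (insert 1 (e ` I))"
  have d: "0 < d" "\<And>b. b \<in> I \<Longrightarrow> d \<le> e b" using assms(1) V(1) by (auto simp: d_def)
  have main: "disjoint_family_on (\<lambda>b. cell_index q ` K b) I \<and>
      (\<forall>b\<in>I. finite (cell_index q ` K b) \<and>
        card (cell_index q ` K b) * q ^ CARD('n) \<le> measure lebesgue (A b) + \<zeta>)"
    if q: "0 < q \<and> CARD('n) * q < d" for q :: real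
  proof -
    have cell_V: "y \<in> V b" if "b \<in> I" "x \<in> K b" "cell_index q x = cell_index q y" for b x y
    proof -
      have "norm (x - y) < e b"
        using cell_diameter[of q x "cell_index q x" y] q d(2)[OF that(1)] that(3) by (simp add: cell_def)
      then have "y \<in> ball x (e b)" by (simp add: dist_norm)
      then show ?thesis using V(2)[OF that(1)] that(2) by blast
    qed
    have "cell_index q ` K b \<inter> cell_index q ` K b' = {}" if "b \<in> I" "b' \<in> I" "b \<noteq> b'" for b b'
    proof (rule ccontr)
      assume "cell_index q ` K b \<inter> cell_index q ` K b' \<noteq> {}"
      then obtain x y where "x \<in> K b" "y \<in> K b'" "cell_index q x = cell_index q y" by auto
      then show False using cell_V[OF that(1)] V(5)[OF that(1,2)] that(3) by blast
    qed
    then have "disjoint_family_on (\<lambda>b. cell_index q ` K b) I" by (simp add: disjoint_family_on_def)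
    moreover have fin: "finite (cell_index q ` K b)" if "b \<in> I" for b
      using finite_cell_index[OF compact_imp_bounded[OF K(2)[OF that]]] q by blast
    moreover have "card (cell_index q ` K b) * q ^ CARD('n) \<le> measure lebesgue (A b) + \<zeta>" if b: "b \<in> I" for b
    proof -
      let ?E = "cell_index q ` K b"
      have "(\<Union>m\<in>?E. cell q m) \<subseteq> V b" using cell_V[OF b] by (auto simp: cell_def)
      then have "measure lebesgue (\<Union>m\<in>?E. cell q m) \<le> measure lebesgue (V b)"
        using measure_cells(1)[of q ?E] q fin[OF b] V(3)[OF b]
        by (intro measure_mono_fmeasurable) (auto simp: fmeasurableD)
      then show ?thesis using measure_cells(2)[of q ?E] q fin[OF b] V(4)[OF b] by simp
    qed
    ultimately show ?thesis by blast
  qed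
  have "\<forall>b\<in>I. K b \<subseteq> A b \<and> compact (K b) \<and> measure lebesgue (A b - K b) \<le> \<zeta>" using K by blast
  then show ?thesis
    by (intro exI[of _ d] conjI exI[of _ K] d(1)) (assumption, intro allI impI, rule main)
qed

text \<open>The push-forward gives \<open>Q\<close> the measure of \<open>Q \<inter> B\<close>. For
  a coarse cube this says that its preimage fits, by volume, into the cube.\<close>

lemma preimage_measure_le:
  assumes U: "U \<in> sets lebesgue" and s: "measure_preserving_on U s" and Q: "Q \<in> sets borel" "Q \<in> lmeasurable"
  shows "{x \<in> U. s x \<in> Q} \<in> sets lebesgue" "measure lebesgue {x \<in> U. s x \<in> Q} \<le> measure lebesgue Q"
proof -
  obtain B where B: "B \<in> sets lebesgue"
    "distr (lebesgue_on U) borel s = distr (lebesgue_on B) borel (\<lambda>x. x)"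
    and sm: "s \<in> borel_measurable (lebesgue_on U)"
    using s by (auto simp: measure_preserving_on_def)
  have eq: "s -` Q \<inter> space (lebesgue_on U) = {x \<in> U. s x \<in> Q}" by auto
  have eq': "s -` Q \<inter> U = {x \<in> U. s x \<in> Q}" by auto
  have "{x \<in> U. s x \<in> Q} \<in> sets (lebesgue_on U)"
    using measurable_sets[OF sm Q(1)] unfolding eq .
  then show meas: "{x \<in> U. s x \<in> Q} \<in> sets lebesgue"
    using U by (simp add: sets_restrict_space_iff)
  have idm: "(\<lambda>x. x) \<in> borel_measurable (lebesgue_on B)"
    by (intro measurable_restrict_space1 measurable_completion) simp
  have "emeasure lebesgue {x \<in> U. s x \<in> Q} = emeasure (distr (lebesgue_on U) borel s) Q"
    using U by (subst emeasure_distr[OF sm Q(1)]) (auto simp: eq' emeasure_restrict_space)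
  also have "\<dots> = emeasure (lebesgue_on B) (Q \<inter> B)"
    unfolding B(2) by (subst emeasure_distr[OF idm Q(1)]) (simp add: vimage_def Int_def)
  also have "\<dots> = emeasure lebesgue (Q \<inter> B)"
    using B(1) by (intro emeasure_restrict_space) auto
  also have "\<dots> \<le> emeasure lebesgue Q"
    by (intro emeasure_mono fmeasurableD[OF Q(2)]) auto
  finally show "measure lebesgue {x \<in> U. s x \<in> Q} \<le> measure lebesgue Q"
    using fmeasurableD2[OF Q(2)] unfolding measure_def by (intro enn2real_mono) (auto simp: less_top)
qed

text \<open>
  \<open>R\<close> does not depend on \<open>\<zeta>\<close>. An additional cell outside \<open>U\<close> is put last, so that every cell that meets
  \<open>U\<close> has a successor.
\<close>

lemma tile_order:
  fixes U :: "(real^'n::finite) set"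
  assumes U: "U \<in> sets lebesgue" "bounded U" and s: "measure_preserving_on U s" and \<eta>: "0 < \<eta>"
  shows "\<exists>R. \<forall>\<zeta>>0. \<exists>q::real>0. \<exists>T (idx :: int^'n \<Rightarrow> nat) G. finite T \<and> inj_on idx T \<and>
    (\<forall>m\<in>T. \<forall>x\<in>cell q m. norm x \<le> R) \<and>
    (\<forall>x\<in>U. \<exists>m\<in>T. \<exists>m'\<in>T. x \<in> cell q m \<and> idx m' = Suc (idx m)) \<and>
    G \<in> sets lebesgue \<and> G \<subseteq> U \<and> measure lebesgue (U - G) \<le> \<zeta> \<and>
    (\<forall>x\<in>G. \<forall>m\<in>T. \<forall>m'\<in>T. x \<in> cell q m \<longrightarrow> idx m' = Suc (idx m) \<longrightarrow>
      (\<forall>y\<in>cell q m'. norm (s x - y) \<le> \<eta>))"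
proof -

  \<comment> \<open>Coarse cells and their preimages under \<open>s\<close>\<close>
  let ?N = "CARD('n)"
  obtain C where C: "AE x in lebesgue_on U. norm (s x) \<le> C"
    using s by (auto simp: measure_preserving_on_def)
  then have "AE x in lebesgue. x \<in> U \<longrightarrow> norm (s x) \<le> C"
    using U(1) by (simp add: AE_restrict_space_iff)
  then obtain N0 where N0: "{x. \<not> (x \<in> U \<longrightarrow> norm (s x) \<le> C)} \<subseteq> N0" "N0 \<in> null_sets lebesgue"
    by (auto elim!: AE_E simp: null_sets_def)
  obtain B0 where B0: "\<And>x. x \<in> U \<Longrightarrow> norm x \<le> B0" using U(2) bounded_iff by metis
  define c0 where "c0 = \<bar>C\<bar> + \<bar>B0\<bar>"
  define Z where "Z = cball (0::real^'n) c0"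
  have UZ: "U \<subseteq> Z" using B0 by (force simp: Z_def c0_def)
  have sZ: "s x \<in> Z" if "x \<in> U" "x \<notin> N0" for x
    using that N0(1) by (force simp: Z_def c0_def)
  \<comment> \<open>Points of one coarse cell are at most \<open>\<eta>\<close> apart, so it
    suffices to hit the right coarse cell.\<close>
  define r0 where "r0 = \<eta> / ?N"
  have r0: "0 < r0" "?N * r0 = \<eta>" using \<eta> by (simp_all add: r0_def)
  define I where "I = cell_index r0 ` Z"
  have finI: "finite I" unfolding I_def Z_def by (rule finite_cell_index[OF bounded_cball r0(1)])
  have bound1: "norm x \<le> c0 + \<eta>" if x: "cell_index r0 x \<in> I" for x
  proof -
    obtain z where z: "z \<in> Z" "cell_index r0 x = cell_index r0 z" using x by (auto simp: I_def)
    have "norm (x - z) \<le> \<eta>" using cell_diameter[OF r0(1), of x "cell_index r0 x" z] z(2) r0(2) by (simp add: cell_def)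
    moreover have "norm z \<le> c0" using z(1) by (simp add: Z_def)
    ultimately show ?thesis using norm_triangle_sub[of x z] by linarith
  qed
  define A where "A b = {x \<in> U. s x \<in> cell r0 b}" for b
  have A: "A b \<in> sets lebesgue" "measure lebesgue (A b) \<le> r0 ^ ?N" for b
    using preimage_measure_le[OF U(1) s cell_measurable cell_lmeasurable[OF r0(1)], of b]
    by (simp_all add: A_def cell_measure[OF r0(1)])
  have AU: "A b \<subseteq> U" for b by (auto simp: A_def)
  have A_disj: "disjoint_family_on A I" by (auto simp: disjoint_family_on_def A_def cell_def)
  \<comment> \<open>Cells inside a coarse cell from \<open>I\<close> stay within norm
    \<open>c0 + \<eta>\<close>. The additional cell contains a point of norm
    \<open>c0 + \<eta> + 1\<close> and has diameter at most \<open>\<eta>\<close>.\<close>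
  define R where "R = c0 + \<eta> + 1 + \<eta>"
  show ?thesis
  proof (rule exI[of _ R], intro allI impI)

    \<comment> \<open>Fine cells and their permutation\<close>
    fix \<zeta> :: real assume \<zeta>: "0 < \<zeta>"
    \<comment> \<open>Three losses of at most \<open>\<zeta> / 3\<close> are allowed: the parts of
      the \<open>A b\<close> outside \<open>K b\<close>, the surplus fine cells, and the last cells
      of the chains.\<close>
    define \<zeta>1 where "\<zeta>1 = \<zeta> / (3 * (card I + 1))"
    have \<zeta>1: "0 < \<zeta>1" "card I * \<zeta>1 \<le> \<zeta> / 3"
      using \<zeta> by (simp_all add: \<zeta>1_def field_simps)
    obtain d K where d: "0 < d"
      and K: "\<And>b. b \<in> I \<Longrightarrow> K b \<subseteq> A b" "\<And>b. b \<in> I \<Longrightarrow> compact (K b)"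
        "\<And>b. b \<in> I \<Longrightarrow> measure lebesgue (A b - K b) \<le> \<zeta>1"
      and Kq: "\<And>q::real. 0 < q \<Longrightarrow> ?N * q < d \<Longrightarrow> disjoint_family_on (\<lambda>b. cell_index q ` K b) I \<and>
        (\<forall>b\<in>I. finite (cell_index q ` K b) \<and>
        card (cell_index q ` K b) * q ^ ?N \<le> measure lebesgue (A b) + \<zeta>1)"
      using compact_cell_approximation[OF finI A_disj \<zeta>1(1) A(1)] bounded_subset[OF U(2) AU]
      by metis
    \<comment> \<open>The coarse grid is subdivided by an integer \<open>k\<close>, large enough for
      \<open>?N * q < d\<close>.\<close>
    obtain k :: nat where k: "\<eta> / d < k" using reals_Archimedean2 by blast
    have "0 < \<eta> / d" using \<eta> d by simp
    then have k0: "0 < k" using k by (metis less_asym of_nat_0_less_iff order.strict_trans)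
    define q where "q = r0 / k"
    have q: "0 < q" using r0(1) k0 by (simp add: q_def)
    have "?N * q = \<eta> / k" using r0(2) by (simp add: q_def)
    also have "\<dots> < d" using k d k0 by (simp add: field_simps)
    finally have qd: "?N * q < d" .
    define E where "E = (\<lambda>b. cell_index q ` K b)"
    have E: "disjoint_family_on E I" "\<And>b. b \<in> I \<Longrightarrow> finite (E b)"
      "\<And>b. b \<in> I \<Longrightarrow> card (E b) * q ^ ?N \<le> measure lebesgue (A b) + \<zeta>1"
      using Kq[OF q qd] by (auto simp: E_def)
    define F where "F b = {m. coarse k m = b}" for b :: "int^'n"
    have F: "finite (F b)" "card (F b) = k ^ ?N" for b
      using coarse_fibre[OF k0, of b] by (simp_all add: F_def)
    have kq: "real (k ^ ?N) * q ^ ?N = r0 ^ ?N"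
      using k0 by (simp add: q_def power_divide)
    \<comment> \<open>A coarse cell holds \<open>k ^ ?N\<close> fine ones, so \<open>E b\<close> is
      cut down to that number. As the volume of \<open>A b\<close> is at most that of a coarse cell,
      the surplus has volume at most \<open>\<zeta>1\<close>.\<close>
    have "\<exists>E'. E' \<subseteq> E b \<and> card E' = min (card (E b)) (k ^ ?N)" if "b \<in> I" for b
      by (metis min.cobounded1 obtain_subset_with_card_n)
    then obtain E' where E': "\<And>b. b \<in> I \<Longrightarrow> E' b \<subseteq> E b"
      "\<And>b. b \<in> I \<Longrightarrow> card (E' b) = min (card (E b)) (k ^ ?N)" by metis
    have lost: "card (E b - E' b) * q ^ ?N \<le> \<zeta>1" if b: "b \<in> I" for b
    proof -
      have fin: "finite (E' b)" using E'(1)[OF b] E(2)[OF b] finite_subset by blast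
      have c: "card (E b - E' b) = card (E b) - min (card (E b)) (k ^ ?N)"
        using card_Diff_subset[OF fin E'(1)[OF b]] E'(2)[OF b] by simp
      show ?thesis
      proof (cases "card (E b) \<le> k ^ ?N")
        case True
        then show ?thesis using c \<zeta>1(1) by simp
      next
        case False
        then have "real (card (E b - E' b)) = real (card (E b)) - real (k ^ ?N)"
          using c by (simp add: of_nat_diff)
        then have "card (E b - E' b) * q ^ ?N = card (E b) * q ^ ?N - r0 ^ ?N"
          using kq by (simp add: left_diff_distrib)
        then show ?thesis using E(3)[OF b] A(2)[of b] by linarith
      qed
    qed
    define T where "T = {m. coarse k m \<in> I}"
    have T_eq: "T = (\<Union>b\<in>I. F b)" by (auto simp: T_def F_def)
    have finT: "finite T" unfolding T_eq using finI F(1) by blast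
    have ci: "coarse k (cell_index q x) = cell_index r0 x" for x :: "real^'n"
      unfolding q_def by (rule cell_index_coarse[OF k0])
    have ZT: "cell_index q x \<in> T" if "x \<in> Z" for x
      using that by (auto simp: T_def ci I_def)
    have ET: "E b \<subseteq> T" if "b \<in> I" for b
      using K(1)[OF that] AU[of b] UZ ZT by (auto simp: E_def)
    have "\<exists>f. bij_betw f T T \<and> (\<forall>b\<in>I. f ` E' b \<subseteq> F b)"
    proof (rule matching_permutation[OF finT finI])
      show "disjoint_family_on E' I" using E(1) E'(1) unfolding disjoint_family_on_def by blast
      show "disjoint_family_on F I" by (auto simp: disjoint_family_on_def F_def)
      show "E' b \<subseteq> T" "F b \<subseteq> T" "card (E' b) \<le> card (F b)" if "b \<in> I" for b
        using that E'[OF that] ET[OF that] T_eq F(2) by auto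
    qed
    then obtain f where f: "bij_betw f T T" "\<And>b. b \<in> I \<Longrightarrow> f ` E' b \<subseteq> F b" by blast

    \<comment> \<open>Breaking up the cycles of the permutation\<close>
    obtain k2 :: nat where k2: "3 * (card T * q ^ ?N) / \<zeta> < k2" using reals_Archimedean2 by blast
    have "0 \<le> 3 * (card T * q ^ ?N) / \<zeta>" using \<zeta> q by simp
    then have k20: "0 < k2" using k2 by (metis less_le_trans not_less of_nat_0_less_iff order_le_less)
    define q2 where "q2 = q / k2"
    have q2: "0 < q2" using q k20 by (simp add: q2_def)
    have ci2: "coarse k2 (cell_index q2 x) = cell_index q x" for x :: "real^'n"
      unfolding q2_def by (rule cell_index_coarse[OF k20])
    \<comment> \<open>At most \<open>card T\<close> cells end a chain, each of volume
      \<open>q2 ^ ?N\<close>; the choice of \<open>k2\<close> suffices because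
      \<open>k2 \<le> k2 ^ ?N\<close>.\<close>
    have small: "card T * q2 ^ ?N \<le> \<zeta> / 3"
    proof -
      have "real k2 \<le> real k2 ^ ?N" using k20 by (intro self_le_power) auto
      then have "3 * (card T * q ^ ?N) / \<zeta> \<le> real k2 ^ ?N" using k2 by linarith
      then have "3 * (card T * q ^ ?N) \<le> \<zeta> * real k2 ^ ?N" using \<zeta> by (simp add: field_simps)
      then show ?thesis using k20 by (simp add: q2_def power_divide field_simps)
    qed
    define T' where "T' = {\<tau>. coarse k2 \<tau> \<in> T}"
    have "T' = (\<Union>t\<in>T. {\<tau>. coarse k2 \<tau> = t})" by (auto simp: T'_def)
    then have finT': "finite T'" using finT coarse_fibre(1)[OF k20] by auto
    have fib: "card {\<tau> \<in> T'. coarse k2 \<tau> = t} = k2 ^ ?N" if "t \<in> T" for t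
    proof -
      have "{\<tau> \<in> T'. coarse k2 \<tau> = t} = {\<tau>. coarse k2 \<tau> = t}" using that by (auto simp: T'_def)
      then show ?thesis using coarse_fibre(2)[OF k20] by simp
    qed
    have "coarse k2 ` T' \<subseteq> T" "0 < k2 ^ ?N" using k20 by (auto simp: T'_def)
    from chain_order[OF finT finT' this(1) fib f(1) this(2)]
    obtain idx L where idx: "bij_betw idx T' {..<card T * k2 ^ ?N}" "L \<subseteq> T'" "card L \<le> card T"
      and step: "\<And>\<tau>. \<tau> \<in> T' - L \<Longrightarrow> \<exists>\<tau>'\<in>T'. idx \<tau>' = Suc (idx \<tau>) \<and> coarse k2 \<tau>' = f (coarse k2 \<tau>)"
      by metis
    let ?W = "card T * k2 ^ ?N"
    have T'_bound: "norm x \<le> c0 + \<eta>" if "cell_index q2 x \<in> T'" for x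
      using that by (intro bound1) (auto simp: T'_def ci2 T_def ci)
    have "0 \<le> c0 + \<eta> + 1" using \<eta> by (simp add: c0_def)
    then obtain a :: "real^'n" where a: "norm a = c0 + \<eta> + 1"
      by (rule vector_choose_size)
    define m0 where "m0 = cell_index q2 a"
    have m0: "m0 \<notin> T'" using T'_bound[of a] a by (auto simp: m0_def)
    \<comment> \<open>Indices on \<open>T'\<close> end at \<open>?W - 1\<close>; the additional cell
      takes \<open>?W\<close> and becomes the successor of the last one.\<close>
    define idx' where "idx' = idx(m0 := ?W)"
    have idx': "idx' m = idx m" "idx m < ?W" if "m \<in> T'" for m
      using that m0 bij_betw_apply[OF idx(1) that] by (auto simp: idx'_def)
    have inj: "inj_on idx' (insert m0 T')"
    proof -
      have "inj_on idx' T'"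
        using bij_betw_imp_inj_on[OF idx(1)] inj_on_cong[of T' idx' idx] idx'(1) by blast
      moreover have "idx' m0 \<notin> idx' ` T'"
      proof
        assume "idx' m0 \<in> idx' ` T'"
        then obtain m where "m \<in> T'" "idx' m = ?W" by (auto simp: idx'_def)
        then show False using idx'[of m] by simp
      qed
      ultimately show ?thesis using m0 by simp
    qed
    have q2\<eta>: "?N * q2 \<le> \<eta>"
    proof -
      have "q2 \<le> q" "q \<le> r0" using k20 k0 q r0(1) by (simp_all add: q2_def q_def field_simps)
      then have "?N * q2 \<le> ?N * r0" by (intro mult_left_mono) auto
      then show ?thesis using r0(2) by simp
    qed
    have R: "norm x \<le> R" if "m \<in> insert m0 T'" "x \<in> cell q2 m" for m x
    proof (cases "m \<in> T'")
      case True
      then show ?thesis using T'_bound[of x] that(2) \<eta> by (simp add: cell_def R_def)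
    next
      case False
      then have "x \<in> cell q2 m0" "a \<in> cell q2 m0" using that by (auto simp: m0_def cell_def)
      then have "norm (x - a) \<le> \<eta>" using cell_diameter[OF q2] q2\<eta> by (meson order_trans)
      then show ?thesis using norm_triangle_sub[of x a] a by (simp add: R_def)
    qed
    have UT': "cell_index q2 x \<in> T'" if "x \<in> U" for x
      using that UZ ZT by (auto simp: T'_def ci2)
    have succ: "\<exists>m\<in>insert m0 T'. \<exists>m'\<in>insert m0 T'. x \<in> cell q2 m \<and> idx' m' = Suc (idx' m)" if "x \<in> U" for x
    proof -
      let ?m = "cell_index q2 x"
      note m = UT'[OF that]
      have "\<exists>m'\<in>insert m0 T'. idx' m' = Suc (idx' ?m)"
      proof (cases "Suc (idx ?m) = ?W")
        case True
        then show ?thesis using idx'(1)[OF m] by (auto simp: idx'_def)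
      next
        case False
        then have "Suc (idx ?m) < ?W" using idx'(2)[OF m] by simp
        then have "Suc (idx ?m) \<in> idx ` T'" using bij_betw_imp_surj_on[OF idx(1)] by simp
        then obtain m' where "m' \<in> T'" "idx m' = Suc (idx ?m)" by auto
        then show ?thesis using idx'(1) m by auto
      qed
      then show ?thesis using m by (auto simp: cell_def)
    qed

    \<comment> \<open>The good set and the measure of its complement\<close>
    have finL: "finite L" using idx(2) finT' finite_subset by blast
    define X where "X b = (\<Union>m\<in>E b - E' b. cell q m)" for b
    define Y where "Y = (\<Union>\<tau>\<in>L. cell q2 \<tau>)"
    \<comment> \<open>\<open>G\<close> keeps the points of \<open>K b\<close> whose fine cell the
      permutation sends into \<open>F b\<close>, and drops the last cells of the chains.\<close>
    define G where "G = (\<Union>b\<in>I. K b \<inter> (\<Union>m\<in>E' b. cell q m)) - Y"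
    have finE': "finite (E' b)" if "b \<in> I" for b using E'(1)[OF that] E(2)[OF that] finite_subset by blast
    have Ks: "K b \<in> sets lebesgue" if "b \<in> I" for b
      using lmeasurable_compact[OF K(2)[OF that]] by (rule fmeasurableD)
    have Ys: "Y \<in> lmeasurable" "measure lebesgue Y \<le> \<zeta> / 3"
    proof -
      show "Y \<in> lmeasurable" unfolding Y_def by (rule measure_cells(1)[OF q2 finL])
      have "measure lebesgue Y = card L * q2 ^ ?N" unfolding Y_def by (rule measure_cells(2)[OF q2 finL])
      also have "\<dots> \<le> card T * q2 ^ ?N" using idx(3) q2 by (intro mult_right_mono) auto
      finally show "measure lebesgue Y \<le> \<zeta> / 3" using small by simp
    qed
    have Xs: "X b \<in> lmeasurable" "measure lebesgue (X b) \<le> \<zeta>1" if "b \<in> I" for b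
      using measure_cells[OF q, of "E b - E' b"] E(2)[OF that] lost[OF that] by (simp_all add: X_def)
    have Gs: "G \<in> sets lebesgue"
      unfolding G_def using finI finE' Ks Ys(1) fmeasurableD[OF measure_cells(1)[OF q finE']]
      by (intro sets.Diff sets.finite_UN sets.Int) (auto simp: fmeasurableD)
    have GU: "G \<subseteq> U" using K(1) AU by (fastforce simp: G_def)
    have AK: "A b - K b \<in> lmeasurable" if "b \<in> I" for b
      using A(1)[of b] Ks[OF that] bounded_subset[OF U(2), of "A b - K b"] AU[of b]
      by (intro bounded_set_imp_lmeasurable) auto
    have bad: "U - G \<subseteq> N0 \<union> ((\<Union>b\<in>I. A b - K b) \<union> ((\<Union>b\<in>I. X b) \<union> Y))"
    proof
      fix x assume x: "x \<in> U - G"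
      show "x \<in> N0 \<union> ((\<Union>b\<in>I. A b - K b) \<union> ((\<Union>b\<in>I. X b) \<union> Y))"
      proof (rule ccontr)
        assume n: "x \<notin> N0 \<union> ((\<Union>b\<in>I. A b - K b) \<union> ((\<Union>b\<in>I. X b) \<union> Y))"
        define b where "b = cell_index r0 (s x)"
        have b: "b \<in> I" using sZ[of x] x n by (auto simp: I_def b_def)
        have "x \<in> A b" using x by (simp add: A_def b_def cell_def)
        then have "x \<in> K b" using n b by blast
        moreover from this have "cell_index q x \<in> E b" by (simp add: E_def)
        then have "cell_index q x \<in> E' b" using n b by (auto simp: X_def cell_def)
        ultimately have "x \<in> G" using n b by (auto simp: G_def cell_def)
        then show False using x by simp
      qed
    qed
    have small_bad: "measure lebesgue (U - G) \<le> \<zeta>"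
    proof -
      have N: "N0 \<in> lmeasurable" "measure lebesgue N0 = 0"
        using N0(2) by (auto simp: null_sets_def fmeasurable_def measure_def)
      have UN: "(\<Union>b\<in>I. H b) \<in> lmeasurable \<and> measure lebesgue (\<Union>b\<in>I. H b) \<le> \<zeta> / 3"
        if "\<And>b. b \<in> I \<Longrightarrow> H b \<in> lmeasurable" "\<And>b. b \<in> I \<Longrightarrow> measure lebesgue (H b) \<le> \<zeta>1" for H
      proof
        show "(\<Union>b\<in>I. H b) \<in> lmeasurable" using that finI by (intro fmeasurable.finite_UN) auto
        have "measure lebesgue (\<Union>b\<in>I. H b) \<le> (\<Sum>b\<in>I. measure lebesgue (H b))"
          using that finI by (intro measure_UNION_le) (auto simp: fmeasurableD)
        also have "\<dots> \<le> card I * \<zeta>1" using sum_mono[of I "\<lambda>b. measure lebesgue (H b)" "\<lambda>_. \<zeta>1"] that(2) by simp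
        finally show "measure lebesgue (\<Union>b\<in>I. H b) \<le> \<zeta> / 3" using \<zeta>1(2) by simp
      qed
      note 1 = UN[of "\<lambda>b. A b - K b", OF AK K(3)] and 2 = UN[of X, OF Xs]
      have "measure lebesgue (U - G) \<le> measure lebesgue (N0 \<union> ((\<Union>b\<in>I. A b - K b) \<union> ((\<Union>b\<in>I. X b) \<union> Y)))"
        using bad U(1) Gs N(1) 1 2 Ys(1) by (intro measure_mono_fmeasurable fmeasurable.Un) auto
      also have "\<dots> \<le> measure lebesgue N0 + (measure lebesgue (\<Union>b\<in>I. A b - K b) +
          (measure lebesgue (\<Union>b\<in>I. X b) + measure lebesgue Y))"
        using N(1) 1 2 Ys(1)
        by (intro order.trans[OF measure_Un_le] add_left_mono fmeasurableD fmeasurable.Un) auto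
      finally show ?thesis using N(2) 1 2 Ys(2) by linarith
    qed
    have good: "norm (s x - y) \<le> \<eta>"
      if x: "x \<in> G" and "m \<in> insert m0 T'" "m' \<in> insert m0 T'" "x \<in> cell q2 m" "idx' m' = Suc (idx' m)" "y \<in> cell q2 m'"
      for x m m' y
    proof -
      obtain b where b: "b \<in> I" "x \<in> K b" "cell_index q x \<in> E' b" "x \<notin> Y"
        using x by (auto simp: G_def cell_def)
      have m: "m = cell_index q2 x" using that(4) by (simp add: cell_def)
      then have mT: "m \<in> T' - L" using UT'[of x] GU x b(4) by (auto simp: Y_def cell_def)
      from step[OF this] obtain \<tau> where \<tau>: "\<tau> \<in> T'" "idx \<tau> = Suc (idx m)" "coarse k2 \<tau> = f (coarse k2 m)" by blast
      \<comment> \<open>By injectivity of the indices, the successor provided by the chain is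
        \<open>m'\<close> itself, so \<open>m'\<close> lies in the coarse cell of
        \<open>s x\<close>.\<close>
      have "idx' \<tau> = idx' m'" using \<tau> mT that(5) idx'(1) by simp
      then have "\<tau> = m'" using inj_onD[OF inj] \<tau>(1) that(3) by blast
      then have "coarse k2 m' = f (cell_index q x)" using \<tau>(3) by (simp add: m ci2)
      then have "coarse k2 m' \<in> F b" using f(2)[OF b(1)] b(3) by auto
      then have "cell_index r0 y = b" using that(6) by (auto simp: F_def cell_def ci2 ci)
      moreover have "cell_index r0 (s x) = b" using K(1)[OF b(1)] b(2) by (auto simp: A_def cell_def)
      ultimately show ?thesis
        using cell_diameter[OF r0(1), of "s x" b y] r0(2) by (simp add: cell_def)
    qed
    show "\<exists>q::real>0. \<exists>T (idx :: int^'n \<Rightarrow> nat) G. finite T \<and> inj_on idx T \<and>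
      (\<forall>m\<in>T. \<forall>x\<in>cell q m. norm x \<le> R) \<and>
      (\<forall>x\<in>U. \<exists>m\<in>T. \<exists>m'\<in>T. x \<in> cell q m \<and> idx m' = Suc (idx m)) \<and>
      G \<in> sets lebesgue \<and> G \<subseteq> U \<and> measure lebesgue (U - G) \<le> \<zeta> \<and>
      (\<forall>x\<in>G. \<forall>m\<in>T. \<forall>m'\<in>T. x \<in> cell q m \<longrightarrow> idx m' = Suc (idx m) \<longrightarrow>
        (\<forall>y\<in>cell q m'. norm (s x - y) \<le> \<eta>))"
      by (intro exI[of _ q2] conjI q2 exI[of _ "insert m0 T'"] exI[of _ idx'] exI[of _ G]
          finite.insertI finT' inj ballI impI R succ Gs GU small_bad good)
  qed
qed

section \<open>The approximation theorem\<close>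

definition inner_cube :: "real \<Rightarrow> real \<Rightarrow> int^'n \<Rightarrow> (real^'n) set" where
  "inner_cube q \<rho> m = {x. \<forall>k. \<bar>(x - cell_center q m) $ k\<bar> \<le> \<rho>}"

lemma inner_cube_measure:
  fixes m :: "int^'n"
  assumes "0 < \<rho>" "\<rho> < q / 2"
  shows "inner_cube q \<rho> m \<subseteq> cell q m" "inner_cube q \<rho> m \<in> lmeasurable"
    "measure lebesgue (cell q m - inner_cube q \<rho> m) = q ^ CARD('n) - (2 * \<rho>) ^ CARD('n)"
proof -
  have q: "0 < q" using assms by simp
  let ?c = "cell_center q m"
  define r where "r = (\<chi> k::'n. \<rho>)"
  have eq: "inner_cube q \<rho> m = cbox (?c - r) (?c + r)"
    by (auto simp: inner_cube_def mem_box_cart r_def abs_le_iff algebra_simps)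
  show sub: "inner_cube q \<rho> m \<subseteq> cell q m"
  proof
    fix x assume "x \<in> inner_cube q \<rho> m"
    then have "\<bar>x $ k - ?c $ k\<bar> \<le> \<rho>" for k by (simp add: inner_cube_def)
    then have "\<bar>x $ k - ?c $ k\<bar> < q / 2" for k using assms(2) by (rule le_less_trans)
    then have "\<bar>x $ k - q * of_int (m $ k) - q / 2\<bar> < q / 2" for k
      by (simp add: cell_center_def algebra_simps)
    then show "x \<in> cell q m"
      unfolding mem_cell[OF q] distrib_left abs_less_iff by (smt (verit) field_sum_of_halves mult.right_neutral)
  qed
  show meas: "inner_cube q \<rho> m \<in> lmeasurable" unfolding eq by simp
  have "cbox (?c - r) (?c + r) \<noteq> {}" using assms(1) by (simp add: interval_ne_empty_cart r_def)
  then have "measure lebesgue (inner_cube q \<rho> m) = (2 * \<rho>) ^ CARD('n)"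
    unfolding eq by (simp add: content_cbox_cart r_def)
  then show "measure lebesgue (cell q m - inner_cube q \<rho> m) = q ^ CARD('n) - (2 * \<rho>) ^ CARD('n)"
    using measurable_measure_Diff[OF cell_lmeasurable[OF q] fmeasurableD[OF meas] sub] cell_measure[OF q, of m]
    by simp
qed

lemma cell_translate:
  assumes "0 < q" "x \<in> cell q m"
  shows "x - cell_center q m + cell_center q m' \<in> cell q m'"
proof -
  have "(x - cell_center q m + cell_center q m') $ k = x $ k - q * of_int (m $ k) + q * of_int (m' $ k)" for k
    by (simp add: cell_center_def algebra_simps)
  then show ?thesis using assms(2) unfolding mem_cell[OF assms(1)] distrib_left by (smt (verit))
qed

text \<open>Shrinking the side by the factor \<open>1 - t\<close> costs at most the fraction
  \<open>n * t\<close> of the volume, by Bernoulli's inequality.\<close>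

lemma thin_rim:
  fixes q e :: real
  assumes "0 < q" "0 < e"
  shows "\<exists>\<rho>. 0 < \<rho> \<and> \<rho> < q / 2 \<and> q ^ n - (2 * \<rho>) ^ n \<le> e"
proof -
  \<comment> \<open>The cap 1/2 keeps \<open>\<rho>\<close> positive, and the added 1 in the
    denominator covers \<open>n = 0\<close>.\<close>
  define t where "t = min (1/2) (e / (n * q ^ n + 1))"
  have den: "0 < n * q ^ n + 1" using assms by (simp add: add_nonneg_pos)
  then have t: "0 < t" "t \<le> 1/2" "t \<le> e / (n * q ^ n + 1)"
    unfolding t_def using assms by (simp, intro min.cobounded1, intro min.cobounded2)
  define \<rho> where "\<rho> = q / 2 * (1 - t)"
  have "1 - n * t \<le> (1 - t) ^ n" using Bernoulli_inequality[of "- t" n] t by simp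
  then have "q ^ n * (1 - n * t) \<le> q ^ n * (1 - t) ^ n" using assms by (intro mult_left_mono) auto
  moreover have "2 * \<rho> = q * (1 - t)" by (simp add: \<rho>_def)
  then have "(2 * \<rho>) ^ n = q ^ n * (1 - t) ^ n" by (simp add: power_mult_distrib)
  ultimately have "q ^ n - (2 * \<rho>) ^ n \<le> t * (n * q ^ n)" by (simp add: algebra_simps)
  also have "\<dots> \<le> t * (n * q ^ n + 1)" using t by simp
  also have "\<dots> \<le> e" using t(3) den by (simp add: field_simps)
  finally have "q ^ n - (2 * \<rho>) ^ n \<le> e" .
  moreover have "0 < \<rho>" "\<rho> < q / 2" using t assms by (auto simp: \<rho>_def)
  ultimately show ?thesis by blast
qed

theorem lemma4p6:
  fixes U :: "(real^('n::finite + 'n)) set"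
    and s :: "real^('n + 'n) \<Rightarrow> real^('n + 'n)"
    and p \<epsilon> :: real
  assumes "open U" and "bounded U" and "connected U" and "lipschitz_boundary U"
    and "measure_preserving_on U s"
    and "1 \<le> p" and "0 < \<epsilon>"
  shows "\<exists>S :: real^('n + 'n) \<Rightarrow> real^('n + 'n).
           smooth_diffeomorphism S \<and> symplectic_on UNIV S \<and> generated_by_hamiltonian S \<and>
           (\<integral>\<^sup>+x. ennreal (norm (s x - S x) powr p) \<partial>lebesgue_on U) \<le> ennreal \<epsilon>"
proof -

  \<comment> \<open>Choice of the accuracies and of the tiling\<close>
  let ?N = "CARD('n + 'n)"
  have Us: "U \<in> sets lebesgue" using borel_open[OF assms(1)] by simp
  have Um: "U \<in> lmeasurable" using bounded_set_imp_lmeasurable assms(2) Us by blast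
  obtain C where C: "AE x in lebesgue_on U. norm (s x) \<le> C"
    using assms(5) by (auto simp: measure_preserving_on_def)
  \<comment> \<open>Chosen so that the good points contribute at most \<open>\<epsilon> / 3\<close>;
    the added 1 keeps the denominator positive also for empty \<open>U\<close>.\<close>
  define \<eta> where "\<eta> = (\<epsilon> / (3 * (measure lebesgue U + 1))) powr (1 / p)"
  have den: "0 < 3 * (measure lebesgue U + 1)" by (simp add: add_nonneg_pos)
  then have \<eta>: "0 < \<eta>" using assms(7) by (simp add: \<eta>_def)
  have "\<eta> powr p = \<epsilon> / (3 * (measure lebesgue U + 1))"
    using assms(6,7) den by (simp add: \<eta>_def powr_powr)
  then have "\<eta> powr p * (measure lebesgue U + 1) = \<epsilon> / 3"
    using den by (simp add: field_simps)
  moreover have "\<eta> powr p * measure lebesgue U \<le> \<eta> powr p * (measure lebesgue U + 1)"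
    by (intro mult_left_mono) auto
  ultimately have \<eta>p: "\<eta> powr p * measure lebesgue U \<le> \<epsilon> / 3" by simp
  obtain R where R: "\<And>\<zeta>. 0 < \<zeta> \<Longrightarrow> \<exists>q::real>0. \<exists>T (idx :: int^('n + 'n) \<Rightarrow> nat) G. finite T \<and> inj_on idx T \<and>
    (\<forall>m\<in>T. \<forall>x\<in>cell q m. norm x \<le> R) \<and>
    (\<forall>x\<in>U. \<exists>m\<in>T. \<exists>m'\<in>T. x \<in> cell q m \<and> idx m' = Suc (idx m)) \<and>
    G \<in> sets lebesgue \<and> G \<subseteq> U \<and> measure lebesgue (U - G) \<le> \<zeta> \<and>
    (\<forall>x\<in>G. \<forall>m\<in>T. \<forall>m'\<in>T. x \<in> cell q m \<longrightarrow> idx m' = Suc (idx m) \<longrightarrow>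
      (\<forall>y\<in>cell q m'. norm (s x - y) \<le> \<eta>))"
    using tile_order[OF Us assms(2,5) \<eta>] by blast
  define K0 where "K0 = \<eta> powr p"
  have K0: "0 \<le> K0" "K0 * measure lebesgue U \<le> \<epsilon> / 3" using \<eta>p by (simp_all add: K0_def)
  \<comment> \<open>Where \<open>S\<close> translates a cube of the tiling onto the next,
    \<open>s x\<close> and \<open>S x\<close> are bounded by \<open>C\<close> and \<open>R\<close>.
    Neither depends on \<open>\<zeta>\<close>, which may therefore be chosen after
    \<open>K1\<close>.\<close>
  define K1 where "K1 = (\<bar>C\<bar> + \<bar>R\<bar>) powr p"
  define \<zeta> where "\<zeta> = \<epsilon> / (3 * (K1 + 1))"
  have K1: "0 \<le> K1" by (simp add: K1_def)
  then have \<zeta>: "0 < \<zeta>" "K1 * \<zeta> \<le> \<epsilon> / 3" using assms(7) by (auto simp: \<zeta>_def field_simps)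
  obtain q T G and idx :: "int^('n + 'n) \<Rightarrow> nat" where q: "(0::real) < q"
    and T: "finite T" "inj_on idx T"
    and T_bound: "\<forall>m\<in>T. \<forall>x\<in>cell q m. norm x \<le> R"
    and T_succ: "\<forall>x\<in>U. \<exists>m\<in>T. \<exists>m'\<in>T. x \<in> cell q m \<and> idx m' = Suc (idx m)"
    and G: "G \<in> sets lebesgue" "G \<subseteq> U" "measure lebesgue (U - G) \<le> \<zeta>"
    and G_near: "\<forall>x\<in>G. \<forall>m\<in>T. \<forall>m'\<in>T. x \<in> cell q m \<longrightarrow> idx m' = Suc (idx m) \<longrightarrow>
      (\<forall>y\<in>cell q m'. norm (s x - y) \<le> \<eta>)"
    using R[OF \<zeta>(1)] by (elim exE conjE) (rule that)
  define idc where "idc c = idx (cell_index q c)" for c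
  have idc: "idc (cell_center q m) = idx m" for m by (simp add: idc_def cell_index_center[OF q])
  have inj: "inj_on idc (cell_center q ` T)"
    using T(2) by (auto simp: inj_on_def idc)
  have sep: "2 * (q / 2) \<le> \<bar>c $ k - c' $ k\<bar>"
    if cT: "c \<in> cell_center q ` T" "c' \<in> cell_center q ` T" and ne: "c $ k \<noteq> c' $ k" for c c' k
  proof -
    obtain m m' where c: "c = cell_center q m" "c' = cell_center q m'" using cT by blast
    have eq: "c $ k - c' $ k = q * of_int (m $ k - m' $ k)" by (simp add: c cell_center_def algebra_simps)
    then have "m $ k - m' $ k \<noteq> 0" using ne by auto
    then have "1 \<le> \<bar>real_of_int (m $ k - m' $ k)\<bar>" by linarith
    then have "q * 1 \<le> q * \<bar>real_of_int (m $ k - m' $ k)\<bar>" using q by (intro mult_left_mono) auto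
    then show ?thesis unfolding eq using q by (simp add: abs_mult)
  qed

  \<comment> \<open>The symplectic map and the rims of the cells\<close>
  have "0 < q / 2" using q by simp
  have "\<exists>M. \<forall>\<rho>. 0 < \<rho> \<and> \<rho> < q / 2 \<longrightarrow> (\<exists>S. smooth_diffeomorphism S \<and> symplectic_on UNIV S \<and>
    generated_by_hamiltonian S \<and> (\<forall>x. norm (S x - x) \<le> M) \<and>
    (\<forall>c\<in>cell_center q ` T. \<forall>c'\<in>cell_center q ` T. idc c' = Suc (idc c) \<longrightarrow>
      (\<forall>x. (\<forall>k. \<bar>(x - c) $ k\<bar> \<le> \<rho>) \<longrightarrow> S x = x - c + c')))"
    by (rule symplectic_shuffle[OF finite_imageI[OF T(1)] \<open>0 < q / 2\<close> inj]) (rule sep)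
  then obtain M where M: "\<forall>\<rho>. 0 < \<rho> \<and> \<rho> < q / 2 \<longrightarrow> (\<exists>S. smooth_diffeomorphism S \<and> symplectic_on UNIV S \<and>
    generated_by_hamiltonian S \<and> (\<forall>x. norm (S x - x) \<le> M) \<and>
    (\<forall>c\<in>cell_center q ` T. \<forall>c'\<in>cell_center q ` T. idc c' = Suc (idc c) \<longrightarrow>
      (\<forall>x. (\<forall>k. \<bar>(x - c) $ k\<bar> \<le> \<rho>) \<longrightarrow> S x = x - c + c')))" ..
  \<comment> \<open>On the rims only the displacement bound \<open>M\<close> controls
    \<open>S\<close>. As \<open>M\<close> is fixed before \<open>\<rho>\<close>, the rims can be
    made thin relative to it.\<close>
  define K2 where "K2 = (\<bar>C\<bar> + \<bar>R\<bar> + \<bar>M\<bar>) powr p"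
  have K2: "0 \<le> K2" by (simp add: K2_def)
  define e where "e = \<epsilon> / (3 * (card T * K2 + 1))"
  have "0 \<le> card T * K2" using K2 by simp
  then have e: "0 < e" "K2 * (card T * e) \<le> \<epsilon> / 3" using assms(7) by (auto simp: e_def field_simps)
  obtain \<rho> where \<rho>: "0 < \<rho>" "\<rho> < q / 2" "q ^ ?N - (2 * \<rho>) ^ ?N \<le> e"
    using thin_rim[OF q e(1)] by blast
  obtain S where S: "smooth_diffeomorphism S" "symplectic_on UNIV S" "generated_by_hamiltonian S"
    "\<And>x. norm (S x - x) \<le> M"
    and S_shift: "\<And>m m' x. m \<in> T \<Longrightarrow> m' \<in> T \<Longrightarrow> idx m' = Suc (idx m) \<Longrightarrow> x \<in> inner_cube q \<rho> m \<Longrightarrow>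
      S x = x - cell_center q m + cell_center q m'"
    using M \<rho>(1,2) unfolding inner_cube_def by (auto simp: idc)
  define Rim where "Rim = (\<Union>m\<in>T. cell q m - inner_cube q \<rho> m)"
  have rim: "cell q m - inner_cube q \<rho> m \<in> lmeasurable" for m :: "int^('n + 'n)"
    using cell_lmeasurable[OF q, of m] inner_cube_measure(2)[OF \<rho>(1,2), of m] by (intro fmeasurable.Diff)
  then have Rim: "Rim \<in> lmeasurable" unfolding Rim_def using T(1) by (intro fmeasurable.finite_UN) auto
  have "measure lebesgue Rim \<le> (\<Sum>m\<in>T. measure lebesgue (cell q m - inner_cube q \<rho> m))"
    unfolding Rim_def using T(1) rim by (intro measure_UNION_le fmeasurableD)
  also have "\<dots> \<le> (\<Sum>m\<in>T. e)"
    by (intro sum_mono) (simp only: inner_cube_measure(3)[OF \<rho>(1,2)] \<rho>(3))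
  also have "\<dots> = card T * e" by simp
  finally have "K2 * measure lebesgue Rim \<le> \<epsilon> / 3"
    using e(2) K2 by (meson mult_left_mono order_trans)

  \<comment> \<open>Pointwise bound of the integrand, and integration\<close>
  have pw: "a powr p \<le> b powr p" if "0 \<le> a" "a \<le> b" for a b :: real
    using that assms(6) by (intro powr_mono2) auto
  have pointwise: "norm (s x - S x) powr p \<le>
      K0 * indicator U x + K1 * indicator (U - G) x + K2 * indicator Rim x"
    if x: "x \<in> U" "norm (s x) \<le> C" for x
  proof -
    obtain m m' where m: "m \<in> T" "m' \<in> T" "x \<in> cell q m" "idx m' = Suc (idx m)" using T_succ x(1) by blast
    show ?thesis
    \<comment> \<open>Three kinds of points: on a rim \<open>M\<close> bounds the displacement; in
      an inner cube \<open>S x\<close> lies in the bounded tiled region; if moreover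
      \<open>x\<close> is in \<open>G\<close>, it lies near \<open>s x\<close>.\<close>
    proof (cases "x \<in> inner_cube q \<rho> m")
      case False
      then have "x \<in> Rim" using m by (auto simp: Rim_def)
      have "norm (s x - S x) \<le> norm (s x) + norm x + norm (S x - x)"
        using norm_triangle_ineq4[of "s x - x" "S x - x"] norm_triangle_ineq4[of "s x" x] by simp
      also have "\<dots> \<le> \<bar>C\<bar> + \<bar>R\<bar> + \<bar>M\<bar>" using x(2) bspec[OF bspec[OF T_bound m(1)] m(3)] S(4)[of x] by linarith
      finally have "norm (s x - S x) powr p \<le> K2" unfolding K2_def by (intro pw) auto
      then show ?thesis using \<open>x \<in> Rim\<close> x(1) K0 K1 by (auto simp: indicator_def)
    next
      case True
      then have Sx: "S x \<in> cell q m'" using S_shift m cell_translate[OF q m(3)] by simp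
      show ?thesis
      proof (cases "x \<in> G")
        case True
        have "norm (s x - S x) \<le> \<eta>" using G_near True m Sx by blast
        then have "norm (s x - S x) powr p \<le> K0" unfolding K0_def by (intro pw) auto
        then show ?thesis using x(1) K0 K1 K2 by (auto simp: indicator_def)
      next
        case False
        have "norm (s x - S x) \<le> norm (s x) + norm (S x)" by (rule norm_triangle_ineq4)
        also have "\<dots> \<le> \<bar>C\<bar> + \<bar>R\<bar>" using x(2) bspec[OF bspec[OF T_bound m(2)] Sx] by linarith
        finally have "norm (s x - S x) powr p \<le> K1" unfolding K1_def by (intro pw) auto
        then show ?thesis using x(1) False K0 K2 by (auto simp: indicator_def)
      qed
    qed
  qed
  have UG: "U - G \<in> lmeasurable" using Um G(1) by (rule fmeasurable_Diff)
  have "(\<integral>\<^sup>+x. ennreal (norm (s x - S x) powr p) \<partial>lebesgue_on U)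
      = (\<integral>\<^sup>+x. ennreal (norm (s x - S x) powr p) * indicator U x \<partial>lebesgue)"
    using Us by (intro nn_integral_restrict_space) simp
  also have "\<dots> \<le> (\<integral>\<^sup>+x. (ennreal (K0) * indicator U x + ennreal K1 * indicator (U - G) x)
      + ennreal K2 * indicator Rim x \<partial>lebesgue)"
  proof (rule nn_integral_mono_AE)
    have "AE x in lebesgue. x \<in> U \<longrightarrow> norm (s x) \<le> C"
      using C Us by (simp add: AE_restrict_space_iff)
    then show "AE x in lebesgue. ennreal (norm (s x - S x) powr p) * indicator U x
      \<le> (ennreal (K0) * indicator U x + ennreal K1 * indicator (U - G) x) + ennreal K2 * indicator Rim x"
    proof eventually_elim
      case (elim x)
      have ind: "ennreal a * indicator B x = ennreal (a * indicator B x)" for a B by (simp add: indicator_def)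
      show ?case
      proof (cases "x \<in> U")
        case True
        then show ?thesis using pointwise[OF True] elim K0 K1 K2
          by (simp only: ind) (simp add: ennreal_plus[symmetric] ennreal_leI del: ennreal_plus)
      qed simp
    qed
  qed
  also have "\<dots> = ennreal (K0) * emeasure lebesgue U + ennreal K1 * emeasure lebesgue (U - G)
      + ennreal K2 * emeasure lebesgue Rim"
    using Us fmeasurableD[OF UG] fmeasurableD[OF Rim]
    by (simp add: nn_integral_add nn_integral_cmult_indicator)
  also have "\<dots> = ennreal (K0 * measure lebesgue U + K1 * measure lebesgue (U - G) + K2 * measure lebesgue Rim)"
    using K0 K1 K2 by (simp add: emeasure_eq_measure2[OF Um] emeasure_eq_measure2[OF UG] emeasure_eq_measure2[OF Rim]
        ennreal_mult ennreal_plus)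
  also have "\<dots> \<le> ennreal \<epsilon>"
  proof (rule ennreal_leI)
    have "K1 * measure lebesgue (U - G) \<le> K1 * \<zeta>" using G(3) K1 by (rule mult_left_mono)
    then show "K0 * measure lebesgue U + K1 * measure lebesgue (U - G) + K2 * measure lebesgue Rim \<le> \<epsilon>"
      using K0(2) \<zeta>(2) \<open>K2 * measure lebesgue Rim \<le> \<epsilon> / 3\<close> by linarith
  qed
  finally show ?thesis using S(1-3) by blast
qed

end
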